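(* Let $v$ be a smooth solution (with smooth pressure $p$) to the stationary Navier-Stokes equations $$(v\cdot\nabla)v=-\nabla p+\Delta v,\qquad \operatorname{div} v=0\qquad\text{on }\mathbb{R}^3,$$ satisfying $|v(x)|\to0$ as $|x|\to+\infty$, and set $\omega=\operatorname{curl} v$. Suppose there exists $q\in[\frac32,3)$ such that $\omega\in L^q(\mathbb{R}^3)$. Set $$\Phi(x,y):=\frac{1}{4\pi}\,\frac{\omega(x)\cdot\big[(x-y)\times(v(y)\times\omega(y))\big]}{|x-y|^3}$$ for all $(x,y)\in\mathbb{R}^3\times\mathbb{R}^3$ with $x\ne y$. Then $$\int_{\mathbb{R}^3}|\Phi(x,y)|\,dy<\infty\ \text{ for every }x\in\mathbb{R}^3,\qquad \int_{\mathbb{R}^3}|\Phi(x,y)|\,dx<\infty\ \text{ for every }y\in\mathbb{R}^3 .$$ Furthermore, if $$\int_{\mathbb{R}^3}\Big(\int_{\mathbb{R}^3}\Phi(x,y)\,dx\Big)dy=\int_{\mathbb{R}^3}\Big(\int_{\mathbb{R}^3}\Phi(x,y)\,dy\Big)dx,$$ then $v=0$ on $\mathbb{R}^3$.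
   Context: Here $v:\mathbb{R}^3\to\mathbb{R}^3$; $\times$ is the cross product and $\cdot$ the Euclidean inner product in $\mathbb{R}^3$. It is not assumed that $\omega\in L^2(\mathbb{R}^3)$; the equality of the two iterated integrals is understood as an equality of extended real numbers. *)

theory Defs
  imports "HOL-Analysis.Analysis"
begin

primrec higher_differentiable ::
  "nat \<Rightarrow> ('a::real_normed_vector \<Rightarrow> 'b::real_normed_vector) \<Rightarrow> bool" where
  "higher_differentiable 0 f \<longleftrightarrow> continuous_on UNIV f"
| "higher_differentiable (Suc n) f \<longleftrightarrow>
     (\<forall>x. f differentiable (at x)) \<and>
     (\<forall>h. higher_differentiable n (\<lambda>x. frechet_derivative f (at x) h))"

definition smooth :: "('a::real_normed_vector \<Rightarrow> 'b::real_normed_vector) \<Rightarrow> bool" where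
  "smooth f \<longleftrightarrow> (\<forall>n. higher_differentiable n f)"

definition partial :: "'n::finite \<Rightarrow> (real^'n \<Rightarrow> 'b::real_normed_vector) \<Rightarrow> real^'n \<Rightarrow> 'b" where
  "partial i f x = frechet_derivative f (at x) (axis i 1)"

definition gradient :: "(real^'n::finite \<Rightarrow> real) \<Rightarrow> real^'n \<Rightarrow> real^'n" where
  "gradient f x = (\<chi> i. partial i f x)"

definition divergence :: "(real^'n::finite \<Rightarrow> real^'n) \<Rightarrow> real^'n \<Rightarrow> real" where
  "divergence u x = (\<Sum>i\<in>UNIV. partial i u x $ i)"

definition laplacian :: "(real^'n::finite \<Rightarrow> 'b::real_normed_vector) \<Rightarrow> real^'n \<Rightarrow> 'b" where
  "laplacian f x = (\<Sum>i\<in>UNIV. partial i (partial i f) x)"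

definition advection ::
  "(real^'n::finite \<Rightarrow> real^'n) \<Rightarrow> (real^'n \<Rightarrow> 'b::real_normed_vector) \<Rightarrow> real^'n \<Rightarrow> 'b" where
  "advection u f x = (\<Sum>i\<in>UNIV. (u x $ i) *\<^sub>R partial i f x)"

definition curl :: "(real^3 \<Rightarrow> real^3) \<Rightarrow> real^3 \<Rightarrow> real^3" where
  "curl u x = vector
     [partial 2 u x $ 3 - partial 3 u x $ 2,
      partial 3 u x $ 1 - partial 1 u x $ 3,
      partial 1 u x $ 2 - partial 2 u x $ 1]"

definition smooth_stationary_navier_stokes :: "(real^3 \<Rightarrow> real^3) \<Rightarrow> (real^3 \<Rightarrow> real) \<Rightarrow> bool" where
  "smooth_stationary_navier_stokes v p \<longleftrightarrow>
     smooth v \<and> smooth p \<and>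
     (\<forall>x. advection v v x = - gradient p x + laplacian v x) \<and>
     (\<forall>x. divergence v x = 0)"

definition in_Lp :: "real \<Rightarrow> ('a::euclidean_space \<Rightarrow> 'b::euclidean_space) \<Rightarrow> bool" where
  "in_Lp q f \<longleftrightarrow> f \<in> borel_measurable lebesgue \<and> integrable lebesgue (\<lambda>x. norm (f x) powr q)"

text \<open>The vorticity \<open>\<omega>\<close> is \<open>curl v\<close>. The kernel is meant for \<open>x \<noteq> y\<close>; on the diagonal,
  a null set in each variable, division by zero gives it the value 0.\<close>

definition Phi :: "(real^3 \<Rightarrow> real^3) \<Rightarrow> real^3 \<Rightarrow> real^3 \<Rightarrow> real" where
  "Phi v x y =
     1 / (4 * pi) *
     ((curl v x \<bullet> cross3 (x - y) (cross3 (v y) (curl v y))) / norm (x - y) ^ 3)"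

text \<open>The Bochner integral is 0 for non-integrable functions, so it cannot express an integral
  with values in the extended reals. Here the integral is that of the positive part minus that
  of the negative part, which may be infinite. In the indeterminate case, where both parts have
  infinite integral, \<^typ>\<open>ereal\<close> arithmetic returns \<open>\<infinity> - \<infinity> = \<infinity>\<close>.\<close>

definition ereal_integral :: "'a measure \<Rightarrow> ('a \<Rightarrow> real) \<Rightarrow> ereal" where
  "ereal_integral M f =
     enn2ereal (\<integral>\<^sup>+ x. ennreal (f x) \<partial>M) - enn2ereal (\<integral>\<^sup>+ x. ennreal (- f x) \<partial>M)"

end

theory Submission
  imports Defs
begin

text \<open>Write \<open>\<omega> = curl v\<close> and \<open>F = v \<times> \<omega>\<close>. The equations give \<open>curl \<omega> = F - \<nabla>(p + |v|\<^sup>2 / 2)\<close>, so both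
  \<open>v\<close> and \<open>\<omega>\<close> are recovered from their curl by the Biot--Savart law:
  \<open>4\<pi> v(y) = \<integral> (x - y) \<times> \<omega>(x) / |x - y|\<^sup>3 dx\<close> and
  \<open>4\<pi> \<omega>(x) = - \<integral> (x - y) \<times> F(y) / |x - y|\<^sup>3 dy\<close>.
  Hence \<open>\<integral> \<Phi>(x, y) dx\<close> is a multiple of \<open>F(y) \<bullet> v(y) = 0\<close>, whereas \<open>\<integral> \<Phi>(x, y) dy = - |\<omega>(x)|\<^sup>2\<close>.
  Equality of the iterated integrals therefore forces \<open>\<omega> = 0\<close>, and then \<open>v = 0\<close> by the first formula.

  The Biot--Savart law for \<open>w = v\<close> or \<open>w = \<omega>\<close> comes from testing against \<open>\<nabla>\<eta>\<close>, where \<open>\<eta>\<close> is the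
  difference of two Newton potentials smoothed at a small and at a large scale:
  \<open>\<integral> w \<Delta>\<eta> = \<integral> \<nabla>\<eta> \<times> curl w\<close>, and \<open>\<Delta>\<eta>\<close> is the difference of two mollifiers. The large-scale average
  of \<open>w\<close> tends to 0 because \<open>v\<close> vanishes at infinity and \<open>|\<omega>(y)| / |x - y|\<^sup>2\<close> is integrable,
  which is where \<open>q < 3\<close> enters.\<close>

subsection \<open>Continuously differentiable functions\<close>

text \<open>Only the partial derivatives are required to be continuous. In finite dimension this
  amounts to continuity of the full derivative, and it can be checked one coordinate direction at a
  time.\<close>

definition C1 :: "(real^'n::finite \<Rightarrow> 'b::real_normed_vector) \<Rightarrow> bool" where
  "C1 f \<longleftrightarrow> (\<forall>x. f differentiable at x) \<and> (\<forall>i. continuous_on UNIV (partial i f))"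

lemma partial_eqI: "(f has_derivative D) (at x) \<Longrightarrow> partial i f x = D (axis i 1)"
  unfolding partial_def by (metis frechet_derivative_at)

lemma C1_has_derivative: "C1 f \<Longrightarrow> (f has_derivative frechet_derivative f (at x)) (at x)"
  unfolding C1_def using frechet_derivative_works by blast

lemma C1_continuous_partial: "C1 f \<Longrightarrow> continuous_on A (partial i f)"
  unfolding C1_def by (meson continuous_on_subset subset_UNIV)

lemma C1_continuous: "C1 f \<Longrightarrow> continuous_on A f"
  unfolding C1_def by (simp add: differentiable_imp_continuous_on differentiable_on_def differentiable_at_withinI)

lemma C1_I:
  assumes "\<And>x. (f has_derivative D x) (at x)" and "\<And>i. continuous_on UNIV (\<lambda>x. D x (axis i 1))"
  shows "C1 f"
proof -
  have "partial i f = (\<lambda>x. D x (axis i 1))" for i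
    using partial_eqI[OF assms(1)] by blast
  then show ?thesis using assms unfolding C1_def differentiable_def by auto
qed

lemma
  assumes "C1 f"
  shows C1_nth: "C1 (\<lambda>x. f x $ j)" and partial_nth: "partial i (\<lambda>x. f x $ j) x = partial i f x $ j"
proof -
  have D: "((\<lambda>x. f x $ j) has_derivative (\<lambda>h. frechet_derivative f (at x) h $ j)) (at x)" for x
    by (rule bounded_linear.has_derivative[OF bounded_linear_vec_nth C1_has_derivative[OF assms]])
  show "partial i (\<lambda>x. f x $ j) x = partial i f x $ j"
    using partial_eqI[OF D] by (simp add: partial_def)
  show "C1 (\<lambda>x. f x $ j)"
    by (rule C1_I[OF D]) (use C1_continuous_partial[OF assms] in \<open>auto simp: partial_def intro!: continuous_intros\<close>)
qed

lemma C1_componentwise: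
  fixes f :: "real^'n::finite \<Rightarrow> real^'m::finite"
  assumes "\<And>j. C1 (\<lambda>x. f x $ j)"
  shows "C1 f"
proof -
  have D: "(f has_derivative (\<lambda>h. \<chi> j. frechet_derivative (\<lambda>x. f x $ j) (at x) h)) (at x)" for x
  proof -
    have "((\<lambda>x. f x \<bullet> b) has_derivative (\<lambda>h. (\<chi> j. frechet_derivative (\<lambda>x. f x $ j) (at x) h) \<bullet> b)) (at x)"
      if "b \<in> Basis" for b
    proof -
      obtain j where "b = axis j 1" using \<open>b \<in> Basis\<close> by (auto simp: Basis_vec_def)
      then show ?thesis using C1_has_derivative[OF assms[of j]] by (simp add: inner_axis)
    qed
    then show ?thesis by (subst has_derivative_componentwise_within) auto
  qed
  show "C1 f"
    by (rule C1_I[OF D])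
       (use C1_continuous_partial[OF assms] in \<open>auto simp: partial_def intro!: continuous_on_vec_lambda\<close>)
qed

lemma
  fixes f g :: "real^'n::finite \<Rightarrow> real"
  assumes "C1 f" "C1 g"
  shows C1_mult: "C1 (\<lambda>x. f x * g x)"
    and partial_mult: "partial i (\<lambda>x. f x * g x) x = f x * partial i g x + partial i f x * g x"
proof -
  note D = has_derivative_mult[OF C1_has_derivative[OF assms(1)] C1_has_derivative[OF assms(2)]]
  show "partial i (\<lambda>x. f x * g x) x = f x * partial i g x + partial i f x * g x"
    using partial_eqI[OF D] by (simp add: partial_def)
  show "C1 (\<lambda>x. f x * g x)"
    by (rule C1_I[OF D])
       (use assms[THEN C1_continuous] assms[THEN C1_continuous_partial]
         in \<open>auto simp: partial_def intro!: continuous_intros\<close>)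
qed

lemma
  assumes "C1 f" "C1 g"
  shows C1_add: "C1 (\<lambda>x. f x + g x)"
    and partial_add: "partial i (\<lambda>x. f x + g x) x = partial i f x + partial i g x"
proof -
  note D = has_derivative_add[OF C1_has_derivative[OF assms(1)] C1_has_derivative[OF assms(2)]]
  show "partial i (\<lambda>x. f x + g x) x = partial i f x + partial i g x"
    using partial_eqI[OF D] by (simp add: partial_def)
  show "C1 (\<lambda>x. f x + g x)"
    by (rule C1_I[OF D])
       (use assms[THEN C1_continuous_partial] in \<open>auto simp: partial_def intro!: continuous_intros\<close>)
qed

lemma
  assumes "C1 f" "C1 g"
  shows C1_diff: "C1 (\<lambda>x. f x - g x)"
    and partial_diff: "partial i (\<lambda>x. f x - g x) x = partial i f x - partial i g x"
proof -
  note D = has_derivative_diff[OF C1_has_derivative[OF assms(1)] C1_has_derivative[OF assms(2)]]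
  show "partial i (\<lambda>x. f x - g x) x = partial i f x - partial i g x"
    using partial_eqI[OF D] by (simp add: partial_def)
  show "C1 (\<lambda>x. f x - g x)"
    by (rule C1_I[OF D])
       (use assms[THEN C1_continuous_partial] in \<open>auto simp: partial_def intro!: continuous_intros\<close>)
qed

lemma
  fixes f :: "real^'n::finite \<Rightarrow> real"
  assumes "C1 f"
  shows C1_cmult: "C1 (\<lambda>x. c * f x)"
    and partial_cmult: "partial i (\<lambda>x. c * f x) x = c * partial i f x"
proof -
  have D: "((\<lambda>x. c * f x) has_derivative (\<lambda>h. c * frechet_derivative f (at x) h)) (at x)" for x
    by (intro has_derivative_mult_right C1_has_derivative assms)
  show "partial i (\<lambda>x. c * f x) x = c * partial i f x"
    using partial_eqI[OF D] by (simp add: partial_def)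
  show "C1 (\<lambda>x. c * f x)"
    by (rule C1_I[OF D])
       (use assms[THEN C1_continuous_partial] in \<open>auto simp: partial_def intro!: continuous_intros\<close>)
qed

section \<open>Smooth functions, coordinate lines and symmetry of second derivatives\<close>

lemma smooth_partial:
  assumes "smooth f" shows "smooth (partial i f)"
proof -
  have "higher_differentiable n (partial i f)" for n
  proof -
    have "higher_differentiable (Suc n) f" using assms unfolding smooth_def by blast
    then show ?thesis unfolding partial_def by simp
  qed
  then show ?thesis unfolding smooth_def by blast
qed

lemma smooth_C1: assumes "smooth f" shows "C1 f"
proof -
  have "higher_differentiable (Suc 0) f" using assms unfolding smooth_def by blast
  then show ?thesis unfolding C1_def partial_def by simp
qed

lemma C1_has_vector_derivative_axis:
  fixes f :: "real^'n::finite \<Rightarrow> 'b::real_normed_vector"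
  assumes "C1 f"
  shows "((\<lambda>t. f (x + t *\<^sub>R axis i 1)) has_vector_derivative partial i f (x + t *\<^sub>R axis i 1)) (at t within S)"
proof -
  have "((\<lambda>t. x + t *\<^sub>R axis i (1::real)) has_derivative (\<lambda>h. h *\<^sub>R axis i 1)) (at t within S)"
    by (auto intro!: derivative_eq_intros)
  from has_derivative_compose[OF this C1_has_derivative[OF assms]]
  have "((\<lambda>t. f (x + t *\<^sub>R axis i 1)) has_derivative
      (\<lambda>h. frechet_derivative f (at (x + t *\<^sub>R axis i 1)) (h *\<^sub>R axis i 1))) (at t within S)" .
  moreover have "linear (frechet_derivative f (at (x + t *\<^sub>R axis i 1)))"
    using assms unfolding C1_def by (blast intro: linear_frechet_derivative)
  ultimately show ?thesis
    unfolding has_vector_derivative_def partial_def by (simp add: linear_scale)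
qed

text \<open>\<open>\<partial>\<^sub>j f(x + s e\<^sub>i) - \<partial>\<^sub>j f(x)\<close> is, by differentiation under the integral, the integral of
  \<open>\<partial>\<^sub>j \<partial>\<^sub>i f\<close> along the segment; compare the derivatives of both expressions at \<open>s = 0\<close>.\<close>

lemma partial_commute:
  fixes f :: "real^'n::finite \<Rightarrow> 'b::euclidean_space"
  assumes f: "C1 f" and f2: "\<And>i. C1 (partial i f)"
  shows "partial i (partial j f) x = partial j (partial i f) x"
proof -
  let ?e = "\<lambda>i::'n. axis i (1::real)"
  let ?h = "\<lambda>s. partial j f (x + s *\<^sub>R ?e i) - partial j f x"
  let ?g = "\<lambda>r. partial j (partial i f) (x + r *\<^sub>R ?e i)"
  have cont: "continuous_on A (\<lambda>r. partial k f (y r))" "continuous_on A (\<lambda>r. partial l (partial k f) (y r))"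
    if "continuous_on A y" for A k l and y :: "'c::topological_space \<Rightarrow> real^'n"
    by (rule continuous_on_compose2[OF C1_continuous_partial[OF f, of UNIV] that]
        continuous_on_compose2[OF C1_continuous_partial[OF f2, of UNIV] that], simp)+
  have h: "?h s = integral {0..s} ?g" if "s \<in> {0..1}" for s
  proof -
    let ?F = "\<lambda>t r. partial i f ((x + r *\<^sub>R ?e i) + t *\<^sub>R ?e j)"
    let ?G = "\<lambda>t r. partial j (partial i f) ((x + r *\<^sub>R ?e i) + t *\<^sub>R ?e j)"
    have leib: "((\<lambda>t. integral (cbox 0 s) (?F t)) has_vector_derivative integral (cbox 0 s) (?G 0))
        (at 0 within UNIV)"
    proof (rule leibniz_rule_vector_derivative[where fx = ?G])
      show "((\<lambda>t. ?F t r) has_vector_derivative ?G t r) (at t within UNIV)" for t r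
        by (rule C1_has_vector_derivative_axis[OF f2])
      show "(?F t) integrable_on cbox 0 s" for t
        by (intro integrable_continuous cont continuous_intros)
      show "continuous_on (UNIV \<times> cbox 0 s) (\<lambda>(t, r). ?G t r)"
        unfolding split_beta by (intro cont continuous_intros)
    qed auto
    have FTC: "integral (cbox 0 s) (?F t) = f ((x + t *\<^sub>R ?e j) + s *\<^sub>R ?e i) - f (x + t *\<^sub>R ?e j)" for t
    proof -
      have "((\<lambda>r. partial i f ((x + t *\<^sub>R ?e j) + r *\<^sub>R ?e i)) has_integral
          f ((x + t *\<^sub>R ?e j) + s *\<^sub>R ?e i) - f ((x + t *\<^sub>R ?e j) + 0 *\<^sub>R ?e i)) {0..s}"
        by (rule fundamental_theorem_of_calculus) (use that C1_has_vector_derivative_axis[OF f] in auto)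
      then have "integral {0..s} (\<lambda>r. partial i f ((x + t *\<^sub>R ?e j) + r *\<^sub>R ?e i)) = f ((x + t *\<^sub>R ?e j) + s *\<^sub>R ?e i) - f (x + t *\<^sub>R ?e j)"
        by (simp add: integral_unique)
      moreover have "?F t = (\<lambda>r. partial i f ((x + t *\<^sub>R ?e j) + r *\<^sub>R ?e i))"
        by (simp add: add_ac)
      ultimately show ?thesis by simp
    qed
    have "((\<lambda>t. f ((x + s *\<^sub>R ?e i) + t *\<^sub>R ?e j) - f (x + t *\<^sub>R ?e j)) has_vector_derivative
        partial j f ((x + s *\<^sub>R ?e i) + 0 *\<^sub>R ?e j) - partial j f (x + 0 *\<^sub>R ?e j)) (at 0 within UNIV)"
      by (intro has_vector_derivative_diff C1_has_vector_derivative_axis f)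
    moreover have "f ((x + s *\<^sub>R ?e i) + t *\<^sub>R ?e j) - f (x + t *\<^sub>R ?e j) = integral (cbox 0 s) (?F t)" for t
      unfolding FTC by (simp only: add_ac)
    ultimately have "((\<lambda>t. integral (cbox 0 s) (?F t)) has_vector_derivative ?h s) (at 0 within UNIV)"
      by simp
    from vector_derivative_unique_at[OF this leib] show ?thesis by simp
  qed
  have "((\<lambda>s. integral {0..s} ?g) has_vector_derivative ?g 0) (at 0 within {0..1})"
    by (rule integral_has_vector_derivative) (auto intro!: cont continuous_intros)
  \<comment> \<open>The integral formula for \<open>?h\<close> is available only for s in [0,1], so
    both derivatives are one-sided at the endpoint 0; they are still unique there.\<close>
  then have 1: "(?h has_vector_derivative ?g 0) (at 0 within {0..1})"
    by (rule has_vector_derivative_transform[where f = "\<lambda>s. integral {0..s} ?g", rotated 2]) (use h in auto)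
  have 2: "(?h has_vector_derivative partial i (partial j f) (x + 0 *\<^sub>R ?e i) - 0) (at 0 within {0..1})"
    by (intro has_vector_derivative_diff C1_has_vector_derivative_axis f2 has_vector_derivative_const)
  show ?thesis
    using vector_derivative_unique_within_closed_interval[unfolded cbox_interval, OF _ _ 2 1] by simp
qed

section \<open>Compactly supported functions and translation invariance\<close>

lemma integrable_compact_support:
  fixes f :: "'a::euclidean_space \<Rightarrow> 'b::{banach, second_countable_topology}"
  assumes "continuous_on UNIV f" and "\<And>y. y \<notin> cball x R \<Longrightarrow> f y = 0"
  shows "integrable lborel f"
proof -
  have "integrable lborel (\<lambda>y. indicator (cball x R) y *\<^sub>R f y)"
    by (rule borel_integrable_compact) (use assms in \<open>auto intro: continuous_on_subset\<close>)
  moreover have "(\<lambda>y. indicator (cball x R) y *\<^sub>R f y) = f"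
    using assms(2) by (auto simp: indicator_def fun_eq_iff)
  ultimately show ?thesis by simp
qed

lemma partial_compact_support:
  fixes f :: "real^'n::finite \<Rightarrow> 'b::real_normed_vector"
  assumes "\<And>y. y \<notin> cball x R \<Longrightarrow> f y = 0" "y \<notin> cball x R"
  shows "partial i f y = 0"
proof -
  have "(f has_derivative (\<lambda>h. 0)) (at y)"
    by (rule has_derivative_transform_within_open[where f = "\<lambda>_. 0" and s = "- cball x R"]) (use assms in auto)
  then show ?thesis by (rule partial_eqI)
qed

lemma integrable_lborel_translate:
  fixes f :: "'a::euclidean_space \<Rightarrow> 'b::{banach, second_countable_topology}"
  assumes "integrable lborel f"
  shows "integrable lborel (\<lambda>x. f (c + x))"
proof -
  have "integrable (distr lborel borel ((+) c)) f" using assms by (simp add: lborel_distr_plus)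
  then show ?thesis by (subst (asm) integrable_distr_eq) (use assms in auto)
qed

lemma integral_lborel_translate:
  fixes f :: "'a::euclidean_space \<Rightarrow> 'b::{banach, second_countable_topology}"
  assumes "f \<in> borel_measurable borel"
  shows "(\<integral>x. f (c + x) \<partial>lborel) = (\<integral>x. f x \<partial>lborel)"
proof -
  have "(\<integral>x. f x \<partial>distr lborel borel ((+) c)) = (\<integral>x. f (c + x) \<partial>lborel)"
    by (rule integral_distr) (use assms in auto)
  then show ?thesis by (simp add: lborel_distr_plus)
qed

text \<open>The difference quotients \<open>s n\<close> have integral 0 by translation invariance of
  Lebesgue measure. They converge pointwise to the partial derivative and are dominated by a
  constant on a fixed ball, so the limit has integral 0 too.\<close>

lemma integral_partial_eq_0:
  fixes f :: "real^'n::finite \<Rightarrow> 'b::euclidean_space"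
  assumes f: "C1 f" and supp: "\<And>y. y \<notin> cball x R \<Longrightarrow> f y = 0"
  shows "(\<integral>y. partial i f y \<partial>lborel) = 0"
proof -
  let ?e = "axis i (1::real) :: real^'n"
  have [measurable]: "f \<in> borel_measurable borel" "partial i f \<in> borel_measurable borel"
    using C1_continuous[OF f] C1_continuous_partial[OF f] by (auto intro: borel_measurable_continuous_onI)
  define s where "s n y = real (Suc n) *\<^sub>R (f (inverse (real (Suc n)) *\<^sub>R ?e + y) - f y)" for n y
  \<comment> \<open>Compactness bounds the derivative on the ball; outside the ball it vanishes, so
    the bound is global.\<close>
  obtain M where M: "norm (partial i f y) \<le> M" for y
  proof -
    have "bounded (partial i f ` cball x R)"
      by (intro compact_imp_bounded compact_continuous_image C1_continuous_partial f) auto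
    then obtain M where M: "\<And>y. y \<in> cball x R \<Longrightarrow> norm (partial i f y) \<le> M" "M > 0"
      unfolding bounded_pos by (metis imageI)
    show thesis
    proof (rule that)
      show "norm (partial i f y) \<le> M" for y
        using M partial_compact_support[where f = f, OF supp] by (cases "y \<in> cball x R") auto
    qed
  qed
  then have M0: "M \<ge> 0" using norm_ge_zero order_trans by blast
  have lip: "norm (f (h *\<^sub>R ?e + y) - f y) \<le> M * h" if "h > 0" for h y
  proof -
    have "norm (f (y + h *\<^sub>R ?e) - f (y + 0 *\<^sub>R ?e)) \<le> M * norm (h - 0)"
    proof (rule differentiable_bound[where S = UNIV])
      show "((\<lambda>t. f (y + t *\<^sub>R ?e)) has_derivative (\<lambda>r. r *\<^sub>R partial i f (y + t *\<^sub>R ?e))) (at t within UNIV)" for t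
        using C1_has_vector_derivative_axis[OF f] unfolding has_vector_derivative_def .
      show "onorm (\<lambda>r. r *\<^sub>R partial i f (y + t *\<^sub>R ?e)) \<le> M" for t
        by (rule onorm_le) (use M mult_left_mono[OF M abs_ge_zero] in \<open>simp add: mult.commute\<close>)
    qed auto
    then show ?thesis using that by (simp add: add.commute)
  qed
  have "(\<lambda>n. \<integral>y. s n y \<partial>lborel) \<longlonglongrightarrow> (\<integral>y. partial i f y \<partial>lborel)"
  proof (rule integral_dominated_convergence[where w = "\<lambda>y. M * indicator (cball x (R + 1)) y"])
    show "integrable lborel (\<lambda>y. M * indicator (cball x (R + 1)) y)"
      by (intro integrable_mult_right integrable_real_indicator) (use emeasure_bounded_finite[of "cball x (R + 1)"] in auto)
    show "AE y in lborel. (\<lambda>n. s n y) \<longlonglongrightarrow> partial i f y"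
    proof (rule AE_I2)
      fix y
      have "((\<lambda>t. f (y + t *\<^sub>R ?e)) has_vector_derivative partial i f (y + 0 *\<^sub>R ?e)) (at 0)"
        by (rule C1_has_vector_derivative_axis[OF f])
      then have "((\<lambda>t. norm (f (y + t *\<^sub>R ?e) - f y - t *\<^sub>R partial i f y) / norm t) \<longlongrightarrow> 0) (at 0)"
        unfolding has_vector_derivative_def has_derivative_at by simp
      moreover have "\<forall>\<^sub>F t in at 0. norm (f (y + t *\<^sub>R ?e) - f y - t *\<^sub>R partial i f y) / norm t =
          norm ((f (y + t *\<^sub>R ?e) - f y) /\<^sub>R t - partial i f y)"
      proof (rule eventually_at_filter[THEN iffD2, OF always_eventually], intro allI impI)
        fix t :: real assume "t \<noteq> 0"
        then have "(f (y + t *\<^sub>R ?e) - f y) /\<^sub>R t - partial i f y =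
            (f (y + t *\<^sub>R ?e) - f y - t *\<^sub>R partial i f y) /\<^sub>R t"
          by (simp add: scaleR_diff_right)
        then show "norm (f (y + t *\<^sub>R ?e) - f y - t *\<^sub>R partial i f y) / norm t =
          norm ((f (y + t *\<^sub>R ?e) - f y) /\<^sub>R t - partial i f y)"
          by (simp only: norm_scaleR) (simp add: divide_inverse mult.commute)
      qed
      ultimately have "((\<lambda>t. norm ((f (y + t *\<^sub>R ?e) - f y) /\<^sub>R t - partial i f y)) \<longlongrightarrow> 0) (at 0)"
        by (rule Lim_transform_eventually)
      then have "((\<lambda>t. (f (y + t *\<^sub>R ?e) - f y) /\<^sub>R t) \<longlongrightarrow> partial i f y) (at 0)"
        by (simp only: tendsto_norm_zero_iff LIM_zero_iff)
      moreover have "filterlim (\<lambda>n. inverse (real (Suc n))) (at 0) sequentially"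
        using LIMSEQ_inverse_real_of_nat by (auto simp: filterlim_at)
      ultimately have "(\<lambda>n. (f (y + inverse (real (Suc n)) *\<^sub>R ?e) - f y) /\<^sub>R inverse (real (Suc n))) \<longlonglongrightarrow> partial i f y"
        by (rule filterlim_compose)
      then show "(\<lambda>n. s n y) \<longlonglongrightarrow> partial i f y" unfolding s_def by (simp add: add.commute)
    qed
    show "AE y in lborel. norm (s n y) \<le> M * indicator (cball x (R + 1)) y" for n
    proof (rule AE_I2)
      fix y
      let ?h = "inverse (real (Suc n))"
      show "norm (s n y) \<le> M * indicator (cball x (R + 1)) y"
      proof (cases "y \<in> cball x (R + 1)")
        case True
        have "norm (s n y) \<le> real (Suc n) * (M * ?h)"
          unfolding s_def norm_scaleR using lip[of ?h y] by (intro mult_mono) auto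
        also have "\<dots> = M" by (simp del: of_nat_Suc)
        finally show ?thesis using True by simp
      next
        \<comment> \<open>The increments have length 1/(n+1), at most 1. Outside radius R + 1 both y
          and its translate therefore miss the support.\<close>
        case False
        have "norm (?h *\<^sub>R ?e) \<le> 1" by (simp add: inverse_le_1_iff del: of_nat_Suc)
        then have "?h *\<^sub>R ?e + y \<notin> cball x R"
          using False dist_triangle[of x y "?h *\<^sub>R ?e + y"] by (simp add: dist_norm norm_minus_commute)
        moreover have "y \<notin> cball x R" using False by auto
        ultimately show ?thesis using M0 supp by (simp add: s_def)
      qed
    qed
  qed (simp_all add: s_def)
  moreover have "(\<integral>y. s n y \<partial>lborel) = 0" for n
  proof -
    have int: "integrable lborel f"
      by (rule integrable_compact_support[OF C1_continuous[OF f] supp])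
    then show ?thesis
      unfolding s_def using integrable_lborel_translate[of f] integral_lborel_translate[of f] by simp
  qed
  ultimately show ?thesis by (simp add: LIMSEQ_const_iff)
qed

subsection \<open>Integration by parts for solenoidal fields\<close>

lemma integrable_partial_compact_support:
  fixes f :: "real^'n::finite \<Rightarrow> 'b::euclidean_space"
  assumes "C1 f" and "\<And>y. y \<notin> cball x R \<Longrightarrow> f y = 0"
  shows "integrable lborel (partial i f)"
  using integrable_compact_support[OF C1_continuous_partial[OF assms(1)]]
    partial_compact_support[where f = f, OF assms(2)] by blast

lemma curl_nth:
  "curl u x $ 1 = partial 2 u x $ 3 - partial 3 u x $ 2"
  "curl u x $ 2 = partial 3 u x $ 1 - partial 1 u x $ 3"
  "curl u x $ 3 = partial 1 u x $ 2 - partial 2 u x $ 1"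
  by (simp_all add: curl_def)

text \<open>In this form each summand is a fixed bounded linear map applied to a partial derivative,
  so integrals and continuity pass through the curl term by term.\<close>

lemma curl_eq_sum_cross3: "curl f y = (\<Sum>i\<in>UNIV. cross3 (axis i 1) (partial i f y))"
  by (simp add: vec_eq_iff forall_3 curl_nth cross_components sum_3 axis_def)

lemma bounded_linear_cross3: "bounded_linear (cross3 a)"
  unfolding linear_conv_bounded_linear[symmetric]
  by (rule linearI) (auto simp: cross_add_right cross_mult_right)

lemma continuous_on_cross3:
  assumes "continuous_on A f" "continuous_on A g"
  shows "continuous_on A (\<lambda>x. cross3 (f x) (g x))"
proof -
  have "continuous_on A (\<lambda>x. cross3 (f x) (g x) $ i)" for i
    using exhaust_3[of i] by (elim disjE; simp only: cross_components) (intro continuous_intros assms)+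
  then show ?thesis using continuous_on_vec_lambda[of A "\<lambda>i x. cross3 (f x) (g x) $ i"] by simp
qed

lemma continuous_on_curl: "C1 u \<Longrightarrow> continuous_on A (curl u)"
  unfolding curl_eq_sum_cross3
  by (intro continuous_on_sum continuous_on_cross3 C1_continuous_partial continuous_on_const)

lemma continuous_on_divergence: "C1 u \<Longrightarrow> continuous_on A (divergence u)"
  unfolding divergence_def by (intro continuous_on_sum continuous_intros C1_continuous_partial)

lemma integral_curl_eq_0:
  assumes "C1 f" and "\<And>y. y \<notin> cball x R \<Longrightarrow> f y = 0"
  shows "(\<integral>y. curl f y \<partial>lborel) = 0"
proof -
  note int = integrable_partial_compact_support[where f = f, OF assms]
  have "(\<integral>y. curl f y \<partial>lborel) = (\<Sum>i\<in>UNIV. \<integral>y. cross3 (axis i 1) (partial i f y) \<partial>lborel)"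
    unfolding curl_eq_sum_cross3
    by (intro Bochner_Integration.integral_sum integrable_bounded_linear[OF bounded_linear_cross3] int)
  also have "\<dots> = (\<Sum>i\<in>UNIV. cross3 (axis i 1) (\<integral>y. partial i f y \<partial>lborel))"
    by (intro sum.cong refl integral_bounded_linear bounded_linear_cross3 int)
  also have "\<dots> = 0"
    using integral_partial_eq_0[OF assms] by simp
  finally show ?thesis .
qed

text \<open>Symmetry of the derivative makes k curl-free, hence curl (Q k) = grad Q x k, and a
  compactly supported curl integrates to 0. This removes the gradient term from the curl of the
  vorticity.\<close>

lemma integral_cross3_gradient_eq_0:
  assumes k: "C1 k" and supp: "\<And>y. y \<notin> cball x R \<Longrightarrow> k y = 0"
    and sym: "\<And>i j y. partial i k y $ j = partial j k y $ i" and Q: "C1 Q"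
  shows "(\<integral>y. cross3 (k y) (gradient Q y) \<partial>lborel) = 0"
proof -
  define f where "f y = (\<chi> i. Q y * k y $ i)" for y
  have f: "C1 f"
    unfolding f_def by (rule C1_componentwise) (simp add: C1_mult Q C1_nth k)
  have "partial i f y $ j = Q y * partial i k y $ j + partial i Q y * k y $ j" for i j y
    using partial_nth[OF f, of i j y, symmetric]
    by (simp add: f_def partial_mult Q C1_nth k partial_nth)
  then have "cross3 (k y) (gradient Q y) = - curl f y" for y
    using sym[where i = 1 and j = 2] sym[where i = 1 and j = 3] sym[where i = 2 and j = 3]
    by (simp add: vec_eq_iff forall_3 curl_nth cross_components gradient_def algebra_simps)
  then show ?thesis
    using integral_curl_eq_0[OF f, of x R] supp by (simp add: f_def zero_vec_def)
qed

text \<open>For \<open>k = \<nabla>\<eta>\<close> this is \<open>\<integral> w \<Delta>\<eta> = \<integral> \<nabla>\<eta> \<times> curl w\<close>: the difference of both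
  integrands is the divergence of the tensor \<open>k\<^sub>j w\<^sub>i + k\<^sub>i w\<^sub>j - (k \<bullet> w) \<delta>\<^sub>i\<^sub>j\<close>.\<close>

lemma integral_divergence_scaleR:
  assumes k: "C1 k" and supp: "\<And>y. y \<notin> cball x R \<Longrightarrow> k y = 0"
    and sym: "\<And>i j y. partial i k y $ j = partial j k y $ i"
    and w: "C1 w" and div: "\<And>y. divergence w y = 0"
  shows "(\<integral>y. divergence k y *\<^sub>R w y \<partial>lborel) = (\<integral>y. cross3 (k y) (curl w y) \<partial>lborel)"
proof -
  let ?T = "\<lambda>i j y. k y $ j * w y $ i + k y $ i * w y $ j"
  let ?D = "\<lambda>y. k y $ 1 * w y $ 1 + k y $ 2 * w y $ 2 + k y $ 3 * w y $ 3"
  \<comment> \<open>\<open>S j\<close> collects the entries of the tensor that are differentiated in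
    direction j, so that each term of its divergence is a partial derivative of a compactly
    supported field.\<close>
  define S :: "3 \<Rightarrow> real^3 \<Rightarrow> real^3" where
    "S j y = (\<chi> i. ?T i j y - (if i = j then ?D y else 0))" for j y
  note kw = C1_nth[OF k] C1_nth[OF w]
  have S_nth: "(\<lambda>y. S j y $ i) = (if i = j then (\<lambda>y. ?T i j y - ?D y) else ?T i j)" for i j
    by (auto simp: S_def)
  have S: "C1 (S j)" for j
  proof (rule C1_componentwise)
    show "C1 (\<lambda>y. S j y $ i)" for i
      unfolding S_nth by (cases "i = j"; simp only: refl if_True if_False) (intro C1_mult C1_add C1_diff kw)+
  qed
  have Ssupp: "S j y = 0" if "y \<notin> cball x R" for j y
    using supp[OF that] by (simp add: S_def vec_eq_iff)
  have pS: "partial l (S j) y $ i = k y $ j * partial l w y $ i + partial l k y $ j * w y $ i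
      + (k y $ i * partial l w y $ j + partial l k y $ i * w y $ j)
      - (if i = j then k y $ 1 * partial l w y $ 1 + partial l k y $ 1 * w y $ 1 +
          (k y $ 2 * partial l w y $ 2 + partial l k y $ 2 * w y $ 2) +
          (k y $ 3 * partial l w y $ 3 + partial l k y $ 3 * w y $ 3) else 0)" for l j i y
    unfolding partial_nth[OF S, symmetric] S_nth
    by (cases "i = j"; simp only: refl if_True if_False diff_zero)
       (simp_all only: partial_mult partial_add partial_diff C1_mult C1_add kw partial_nth[OF k] partial_nth[OF w])
  have eq: "divergence k y *\<^sub>R w y - cross3 (k y) (curl w y) = (\<Sum>j\<in>UNIV. partial j (S j) y)" for y
  proof -
    \<comment> \<open>Solenoidality eliminates one derivative of w and \<open>s\<close> orients the
      mixed derivatives of k; what remains is a polynomial identity.\<close>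
    have d: "partial 3 w y $ 3 = - partial 1 w y $ 1 - partial 2 w y $ 2"
      using div[of y] by (simp add: divergence_def sum_3)
    note s = sym[where i = 2 and j = 1] sym[where i = 3 and j = 1] sym[where i = 3 and j = 2]
    show ?thesis
      by (simp add: vec_eq_iff forall_3 sum_3 pS divergence_def cross_components curl_nth d s algebra_simps)
  qed
  have "integrable lborel (\<lambda>y. divergence k y *\<^sub>R w y)"
  proof (rule integrable_compact_support[where x = x and R = R])
    show "continuous_on UNIV (\<lambda>y. divergence k y *\<^sub>R w y)"
      by (intro continuous_on_scaleR continuous_on_divergence C1_continuous k w)
    show "divergence k y *\<^sub>R w y = 0" if "y \<notin> cball x R" for y
      using partial_compact_support[where f = k, OF supp that] by (simp add: divergence_def)
  qed
  moreover have "integrable lborel (\<lambda>y. cross3 (k y) (curl w y))"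
  proof (rule integrable_compact_support[where x = x and R = R])
    show "continuous_on UNIV (\<lambda>y. cross3 (k y) (curl w y))"
      by (intro continuous_on_cross3 continuous_on_curl w C1_continuous[OF k])
  qed (simp add: supp)
  ultimately have "(\<integral>y. divergence k y *\<^sub>R w y \<partial>lborel) - (\<integral>y. cross3 (k y) (curl w y) \<partial>lborel) =
      (\<integral>y. (\<Sum>j\<in>UNIV. partial j (S j) y) \<partial>lborel)"
    unfolding eq[symmetric] by simp
  also have "\<dots> = (\<Sum>j\<in>UNIV. \<integral>y. partial j (S j) y \<partial>lborel)"
    by (intro Bochner_Integration.integral_sum integrable_partial_compact_support[where x = x and R = R] S Ssupp)
  also have "\<dots> = 0"
    by (intro sum.neutral ballI integral_partial_eq_0[where x = x and R = R] S Ssupp)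
  finally show ?thesis by simp
qed

text \<open>These fields are minus the gradients of radial potentials, whence the visibly symmetric
  derivative matrix. Taking the squared distance as variable avoids the singularity of the norm at
  the centre.\<close>

lemma
  fixes B B' :: "real \<Rightarrow> real" and x :: "real^'n::finite"
  assumes B: "\<And>s. (B has_real_derivative B' s) (at s)" and B': "continuous_on UNIV B'"
  defines "k \<equiv> \<lambda>y. - (B ((y - x) \<bullet> (y - x)) *\<^sub>R (y - x))"
  shows C1_radial_field: "C1 k"
    and partial_radial_field: "partial i k y $ j = - (B ((y - x) \<bullet> (y - x)) * (if i = j then 1 else 0)
        + 2 * B' ((y - x) \<bullet> (y - x)) * (y - x) $ i * (y - x) $ j)"
proof -
  have D: "(k has_derivative (\<lambda>h. - (B ((y - x) \<bullet> (y - x)) *\<^sub>R h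
      + (2 * ((y - x) \<bullet> h) * B' ((y - x) \<bullet> (y - x))) *\<^sub>R (y - x)))) (at y)" for y
  proof -
    have "((\<lambda>y. (y - x) \<bullet> (y - x)) has_derivative (\<lambda>h. 2 * ((y - x) \<bullet> h))) (at y)"
      by (auto intro!: derivative_eq_intros simp: inner_commute)
    from has_derivative_compose[OF this B[unfolded has_field_derivative_def]]
    have "((\<lambda>y. B ((y - x) \<bullet> (y - x))) has_derivative (\<lambda>h. 2 * ((y - x) \<bullet> h) * B' ((y - x) \<bullet> (y - x)))) (at y)"
      by (simp add: mult.commute)
    then show ?thesis
      unfolding k_def by (auto intro!: derivative_eq_intros)
  qed
  have "continuous_on UNIV B"
    using B by (meson DERIV_continuous_on has_field_derivative_at_within)
  then have "continuous_on UNIV (\<lambda>y. B ((y - x) \<bullet> (y - x)))" "continuous_on UNIV (\<lambda>y. B' ((y - x) \<bullet> (y - x)))"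
    by (auto intro!: continuous_intros continuous_on_compose2[of UNIV B] continuous_on_compose2[OF B'])
  then show "C1 k"
    by (intro C1_I[OF D] continuous_intros)
  show "partial i k y $ j = - (B ((y - x) \<bullet> (y - x)) * (if i = j then 1 else 0)
        + 2 * B' ((y - x) \<bullet> (y - x)) * (y - x) $ i * (y - x) $ j)"
    unfolding partial_eqI[OF D] by (simp add: inner_axis) (auto simp: axis_def)
qed

subsection \<open>Integrability of Riesz kernels\<close>

lemma integrable_countable_ball_cover:
  fixes f :: "'a::euclidean_space \<Rightarrow> real"
  assumes [measurable]: "f \<in> borel_measurable borel"
    and nonneg: "\<And>z. f z \<ge> 0" "\<And>k. c k \<ge> 0" "\<And>k. r k \<ge> 0"
    and cover: "\<And>z. f z \<noteq> 0 \<Longrightarrow> \<exists>k::nat. norm z < r k \<and> f z \<le> c k"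
    and sum: "summable (\<lambda>k. c k * r k ^ DIM('a))"
  shows "integrable lborel f"
proof (rule integrableI_bounded)
  let ?V = "unit_ball_vol (real DIM('a))"
  have le: "ennreal (norm (f z)) \<le> (\<Sum>k. ennreal (c k) * indicator (ball 0 (r k)) z)" for z
  proof (cases "f z = 0")
    case False
    then obtain k where k: "norm z < r k" "f z \<le> c k" using cover by blast
    then have "ennreal (norm (f z)) \<le> ennreal (c k) * indicator (ball 0 (r k)) z"
      using nonneg by (simp add: ennreal_leI)
    also have "\<dots> = (\<Sum>k\<in>{k}. ennreal (c k) * indicator (ball 0 (r k)) z)"
      by (subst sum.insert) auto
    also have "\<dots> \<le> (\<Sum>k. ennreal (c k) * indicator (ball 0 (r k)) z)"
      by (rule sum_le_suminf) auto
    finally show ?thesis .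
  qed simp
  have "(\<integral>\<^sup>+z. ennreal (norm (f z)) \<partial>lborel)
      \<le> (\<integral>\<^sup>+z. (\<Sum>k. ennreal (c k) * indicator (ball 0 (r k)) (z::'a)) \<partial>lborel)"
    by (intro nn_integral_mono le)
  also have "\<dots> = (\<Sum>k. \<integral>\<^sup>+z. ennreal (c k) * indicator (ball 0 (r k)) (z::'a) \<partial>lborel)"
    by (rule nn_integral_suminf) (intro borel_measurable_times_ennreal borel_measurable_const borel_measurable_indicator, simp)
  also have "\<dots> = (\<Sum>k. ennreal (?V * (c k * r k ^ DIM('a))))"
    using nonneg by (simp add: nn_integral_cmult_indicator emeasure_ball ennreal_mult[symmetric] mult_ac)
  also have "\<dots> = ennreal (\<Sum>k. ?V * (c k * r k ^ DIM('a)))"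
    by (intro suminf_ennreal2 summable_mult sum) (use nonneg in auto)
  finally have "(\<integral>\<^sup>+z. ennreal (norm (f z)) \<partial>lborel) \<le> ennreal (\<Sum>k. ?V * (c k * r k ^ DIM('a)))" .
  then show "(\<integral>\<^sup>+z. ennreal (norm (f z)) \<partial>lborel) < \<infinity>"
    by (rule order_le_less_trans) simp
qed simp

lemma ex_dyadic:
  assumes "(1::real) \<le> t"
  shows "\<exists>k. 2 ^ k \<le> t \<and> t < 2 ^ Suc k"
proof -
  define k where "k = nat \<lfloor>log 2 t\<rfloor>"
  have "0 \<le> log 2 t" using assms by simp
  then have "real k \<le> log 2 t" "log 2 t < real (Suc k)" unfolding k_def by linarith+
  then have "2 powr real k \<le> t" "t < 2 powr real (Suc k)"
    using assms by (simp_all add: le_log_iff log_less_iff)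
  then have "2 ^ k \<le> t" "t < 2 ^ Suc k" by (simp_all only: powr_realpow zero_less_numeral)
  then show ?thesis by blast
qed

text \<open>On the dyadic shell where 1 / |z| lies in [2^k, 2^(k+1)) the function is at most 4 *
  4^k, and the shell lies in a ball of radius 2 * 2^(-k). The series has terms 32 * 2^(-k).\<close>

lemma integrable_inverse_norm_sq_near_0:
  "integrable lborel (\<lambda>z::real^3. indicator (ball 0 1) z / norm z ^ 2)"
proof (rule integrable_countable_ball_cover[where c = "\<lambda>k. 4 * 4 ^ k" and r = "\<lambda>k. 2 * (1/2) ^ k"])
  have *: "(2 * h) ^ DIM(real^3) = 8 * (h * h * h)" for h :: real
    by (simp add: power3_eq_cube)
  have "4 * 4 ^ k * (2 * (1 / 2) ^ k) ^ DIM(real^3) = (32 * (1/2) ^ k :: real)" for k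
  proof -
    have "4 * 4 ^ k * (2 * (1 / 2) ^ k) ^ DIM(real^3) = 32 * (4 ^ k * (1/2) ^ k * (1/2) ^ k) * (1/2 :: real) ^ k"
      unfolding * by (simp only: mult_ac)
    also have "(4 ^ k * (1/2) ^ k * (1/2) ^ k) = (1::real)" by (simp only: power_mult_distrib[symmetric]) simp
    finally show ?thesis by (simp only: mult_1_right)
  qed
  then show "summable (\<lambda>k. 4 * 4 ^ k * (2 * (1 / 2) ^ k) ^ DIM(real^3) :: real)"
    by (simp only:) (simp add: summable_geometric summable_mult)
  fix z :: "real^3" assume "indicator (ball 0 1) z / (norm z)\<^sup>2 \<noteq> (0::real)"
  then have z: "0 < norm z" "norm z < 1" by (auto simp: indicator_def split: if_splits)
  then obtain k where k: "2 ^ k \<le> 1 / norm z" "1 / norm z < 2 ^ Suc k"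
    using ex_dyadic[of "1 / norm z"] by auto
  have "norm z < 2 * (1/2) ^ k"
  proof -
    have "norm z \<le> (1/2) ^ k" using k(1) z by (simp add: field_simps)
    also have "\<dots> < 2 * (1/2) ^ k" by simp
    finally show ?thesis .
  qed
  moreover have "indicator (ball 0 1) z / (norm z)\<^sup>2 \<le> (4 * 4 ^ k :: real)"
  proof -
    have "indicator (ball 0 1) z / (norm z)\<^sup>2 = (1 / norm z)\<^sup>2" using z by (simp add: power_divide)
    also have "\<dots> \<le> (2 ^ Suc k)\<^sup>2" using k(2) z by (intro power_mono) auto
    also have "\<dots> = 4 * 4 ^ k" by (simp add: power2_eq_square flip: power_mult_distrib)
    finally show ?thesis .
  qed
  ultimately show "\<exists>k. norm z < 2 * (1/2) ^ k \<and> indicator (ball 0 1) z / (norm z)\<^sup>2 \<le> (4 * 4 ^ k :: real)"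
    by blast
qed (auto intro!: borel_measurable_divide borel_measurable_indicator borel_measurable_power)

text \<open>The same decomposition into shells 2^k <= |z| < 2^(k+1) gives a geometric series of
  ratio 2^(3 - s), which is below 1.\<close>

lemma integrable_norm_powr_at_infinity:
  assumes "3 < s"
  shows "integrable lborel (\<lambda>z::real^3. indicator (- ball 0 1) z * norm z powr (- s))"
proof (rule integrable_countable_ball_cover[where c = "\<lambda>k. (2 powr - s) ^ k" and r = "\<lambda>k. 2 * 2 ^ k"])
  have "2 powr (- s) * 8 = 2 powr (3 - s)" using powr_add[of 2 3 "- s"] by simp
  also have "\<dots> < 1" using assms by (simp add: powr_less_one)
  finally have *: "2 powr (- s) * 8 < 1" .
  have "(2 powr - s) ^ k * (2 * 2 ^ k) ^ DIM(real^3) = 8 * (2 powr (- s) * 8) ^ k" for k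
  proof -
    have "(8::real) ^ k = 2 ^ k * 2 ^ k * 2 ^ k" by (simp only: power_mult_distrib[symmetric]) simp
    then show ?thesis by (simp add: power_mult_distrib power3_eq_cube)
  qed
  then show "summable (\<lambda>k. (2 powr - s) ^ k * (2 * 2 ^ k) ^ DIM(real^3))"
    by (simp only:) (use * in \<open>intro summable_mult summable_geometric, simp\<close>)
  fix z :: "real^3" assume "indicator (- ball 0 1) z * norm z powr (- s) \<noteq> 0"
  then have z: "1 \<le> norm z" by (auto simp: indicator_def split: if_splits)
  then obtain k where k: "2 ^ k \<le> norm z" "norm z < 2 ^ Suc k"
    using ex_dyadic by blast
  have "norm z powr (- s) \<le> (2 ^ k) powr (- s)"
    using k(1) assms by (intro powr_mono2') auto
  also have "\<dots> = (2 powr - s) ^ k"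
    by (simp add: powr_powr mult.commute flip: powr_realpow)
  finally show "\<exists>k. norm z < 2 * 2 ^ k \<and> indicator (- ball 0 1) z * norm z powr (- s) \<le> (2 powr - s) ^ k"
    using k z by (intro exI[of _ k]) auto
qed auto

text \<open>Within distance 1 of x, G is bounded by continuity and the kernel is locally integrable.
  Farther out, Young's inequality with the conjugate exponent q' leaves |G|^q and |y - x|^(-2 q');
  the latter is integrable at infinity because 2 q' > 3 is equivalent to q < 3.\<close>

lemma integrable_Lp_over_dist_sq:
  fixes G :: "real^3 \<Rightarrow> 'b::euclidean_space"
  assumes cont: "continuous_on UNIV G" and q: "1 < q" "q < 3" and Lp: "in_Lp q G"
  shows "integrable lborel (\<lambda>y. norm (G y) / norm (y - x) ^ 2)"
proof -
  define q' where "q' = q / (q - 1)"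
  have q': "q' > 1" "1 / q + 1 / q' = 1" "2 * q' > 3"
    using q by (simp_all add: q'_def field_simps)
  have [measurable]: "G \<in> borel_measurable borel"
    using cont by (rule borel_measurable_continuous_onI)
  obtain M where M: "M \<ge> 0" "\<And>y. y \<in> cball x 1 \<Longrightarrow> norm (G y) \<le> M"
  proof -
    have "bounded (G ` cball x 1)"
      by (intro compact_imp_bounded compact_continuous_image continuous_on_subset[OF cont]) auto
    then obtain M where "M > 0" "\<forall>y\<in>cball x 1. norm (G y) \<le> M" unfolding bounded_pos by auto
    then show thesis using that[of M] by auto
  qed
  let ?A = "\<lambda>z::real^3. indicator (ball 0 1) z / norm z ^ 2"
  let ?B = "\<lambda>z::real^3. indicator (- ball 0 1) z * norm z powr (- (2 * q'))"
  \<comment> \<open>\<open>in_Lp\<close> refers to the completed measure; since G is Borel,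
    integrability descends to \<open>lborel\<close>.\<close>
  have "integrable lborel (\<lambda>y. norm (G y) powr q)"
    using Lp unfolding in_Lp_def by (subst (asm) integrable_completion) auto
  then have int: "integrable lborel (\<lambda>y. M * ?A (- x + y) + norm (G y) powr q + ?B (- x + y))"
    using integrable_lborel_translate[OF integrable_inverse_norm_sq_near_0]
      integrable_lborel_translate[OF integrable_norm_powr_at_infinity[OF q'(3)]]
    by (intro Bochner_Integration.integrable_add integrable_mult_right)
  have le: "norm (G y) / norm (y - x) ^ 2 \<le> M * ?A (- x + y) + norm (G y) powr q + ?B (- x + y)" for y
  proof (cases "norm (y - x) < 1")
    case True
    then have "norm (G y) \<le> M" by (intro M) (simp add: dist_norm norm_minus_commute)
    then have "norm (G y) / norm (y - x) ^ 2 \<le> M * ?A (y - x)"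
      using True by (simp add: divide_right_mono)
    from add_mono[OF this powr_ge_zero[of "norm (G y)" q]] show ?thesis using True by simp
  next
    case False
    let ?t = "1 / norm (y - x) ^ 2"
    have "norm (G y) * ?t \<le> norm (G y) powr q / q + ?t powr q' / q'"
      by (rule Youngs_inequality) (use q q' in auto)
    also have "\<dots> \<le> norm (G y) powr q + ?t powr q'"
    proof -
      have "a / r \<le> a" if "1 < r" "0 \<le> a" for a r :: real
        using that mult_left_mono[of 1 r a] by (simp add: divide_le_eq)
      then show ?thesis using q q' by (intro add_mono) auto
    qed
    also have "?t powr q' = norm (y - x) powr (- (2 * q'))"
    proof -
      have "?t = norm (y - x) powr (- 2)" using False by (simp add: powr_minus powr_numeral divide_inverse)
      then show ?thesis by (simp add: powr_powr)
    qed
    finally show ?thesis using False by simp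
  qed
  show ?thesis
  proof (rule Bochner_Integration.integrable_bound[OF int _ AE_I2])
    show "norm (norm (G y) / norm (y - x) ^ 2) \<le> norm (M * ?A (- x + y) + norm (G y) powr q + ?B (- x + y))" for y
      using order_trans[OF le abs_ge_self, of y] by simp
  qed simp
qed

subsection \<open>Mollifiers\<close>

text \<open>The argument s stands for a squared distance. The profile is the one produced by the
  divergence of the smoothed Newton field in \<open>newton_divergence\<close>. It is not normalised:
  for every positive r its mass is \<open>mollifier_mass\<close>.\<close>

definition mollifier :: "real \<Rightarrow> real \<Rightarrow> real" where
  "mollifier r s = max 0 (1 - s / r\<^sup>2) / r ^ 3"

definition mollify :: "real \<Rightarrow> real^3 \<Rightarrow> (real^3 \<Rightarrow> real^3) \<Rightarrow> real^3" where
  "mollify r x w = (\<integral>y. mollifier r ((y - x) \<bullet> (y - x)) *\<^sub>R w y \<partial>lborel)"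

definition mollifier_mass :: real where
  "mollifier_mass = (\<integral>z. max 0 (1 - z \<bullet> z) \<partial>(lborel :: (real^3) measure))"

lemma integral_lborel_affine:
  fixes f :: "'a::euclidean_space \<Rightarrow> 'b::{banach, second_countable_topology}"
  assumes [measurable]: "f \<in> borel_measurable borel" and "c > 0"
  shows "(\<integral>y. f y \<partial>lborel) = c ^ DIM('a) *\<^sub>R (\<integral>z. f (x + c *\<^sub>R z) \<partial>lborel)"
proof -
  have "(\<integral>y. f y \<partial>lborel) =
      (\<integral>y. f y \<partial>density (distr lborel borel (\<lambda>z. x + c *\<^sub>R z)) (\<lambda>_. ennreal (c ^ DIM('a))))"
    using lborel_affine[of c x] \<open>c > 0\<close> by simp
  also have "\<dots> = (\<integral>y. c ^ DIM('a) *\<^sub>R f y \<partial>distr lborel borel (\<lambda>z. x + c *\<^sub>R z))"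
    using \<open>c > 0\<close> by (subst integral_density) auto
  also have "\<dots> = (\<integral>z. c ^ DIM('a) *\<^sub>R f (x + c *\<^sub>R z) \<partial>lborel)"
    by (subst integral_distr) auto
  finally show ?thesis by simp
qed

text \<open>The substitution y = x + r z has Jacobian r^3, cancelling the factor in the mollifier.
  The weight is now independent of r, as dominated convergence requires.\<close>

lemma mollify_rescaled:
  assumes w: "continuous_on UNIV w" and "r > 0"
  shows "mollify r x w = (\<integral>z. max 0 (1 - z \<bullet> z) *\<^sub>R w (x + r *\<^sub>R z) \<partial>lborel)"
proof -
  have [measurable]: "w \<in> borel_measurable borel"
    using w by (rule borel_measurable_continuous_onI)
  have "mollify r x w = r ^ DIM(real^3) *\<^sub>R
      (\<integral>z. mollifier r ((x + r *\<^sub>R z - x) \<bullet> (x + r *\<^sub>R z - x)) *\<^sub>R w (x + r *\<^sub>R z) \<partial>lborel)"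
    unfolding mollify_def mollifier_def by (rule integral_lborel_affine) (use \<open>r > 0\<close> in measurable)
  also have "\<dots> = (\<integral>z. r ^ 3 *\<^sub>R mollifier r ((x + r *\<^sub>R z - x) \<bullet> (x + r *\<^sub>R z - x)) *\<^sub>R w (x + r *\<^sub>R z) \<partial>lborel)"
    by (subst integral_scaleR_right) simp
  also have "\<dots> = (\<integral>z. max 0 (1 - z \<bullet> z) *\<^sub>R w (x + r *\<^sub>R z) \<partial>lborel)"
    using \<open>r > 0\<close> by (simp add: mollifier_def power2_eq_square)
  finally show ?thesis .
qed

lemma max_0_le_indicator:
  fixes z :: "'a::real_inner"
  shows "max 0 (1 - z \<bullet> z) \<le> indicator (cball 0 1) z"
proof (cases "norm z \<le> 1")
  case False
  then have "1 \<le> norm z ^ 2" by (simp add: one_le_power)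
  then show ?thesis using False by (simp add: power2_norm_eq_inner)
qed simp

lemma integrable_cball_indicator: "integrable lborel (\<lambda>z. M * indicator (cball 0 1) (z::'a::euclidean_space) :: real)"
  by (intro integrable_mult_right integrable_real_indicator)
     (use emeasure_bounded_finite[of "cball (0::'a) 1"] in auto)

lemma integrable_max_0_one_minus:
  "integrable lborel (\<lambda>z::'a::euclidean_space. max 0 (1 - z \<bullet> z))"
proof (rule Bochner_Integration.integrable_bound[OF integrable_cball_indicator[of 1]])
  show "AE z::'a in lborel. norm (max 0 (1 - z \<bullet> z)) \<le> norm (1 * indicator (cball 0 1) z :: real)"
    using max_0_le_indicator by (intro AE_I2) (simp add: abs_of_nonneg)
qed simp

text \<open>A nonnegative integrable function with integral 0 vanishes almost everywhere, but this
  one is positive on the open unit ball, which has positive volume.\<close>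

lemma mollifier_mass_pos: "mollifier_mass > 0"
proof -
  have "mollifier_mass \<noteq> 0"
  proof
    assume "mollifier_mass = 0"
    then have "AE z::real^3 in lborel. max 0 (1 - z \<bullet> z) = 0"
      unfolding mollifier_mass_def
      by (subst (asm) integral_nonneg_eq_0_iff_AE[OF integrable_max_0_one_minus]) auto
    then have "AE z::real^3 in lborel. z \<notin> ball 0 1"
    proof (rule AE_mp, intro AE_I2 impI)
      fix z :: "real^3" assume "max 0 (1 - z \<bullet> z) = 0"
      then have "1 \<le> norm z ^ 2" by (simp add: power2_norm_eq_inner max_def split: if_splits)
      then show "z \<notin> ball 0 1" using abs_square_less_1[of "norm z"] by auto
    qed
    then have "emeasure lborel (ball (0::real^3) 1) = 0"
    proof (subst (asm) AE_iff_measurable)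
      show "{z \<in> space lborel. \<not> z \<notin> ball (0::real^3) 1} = ball 0 1" by auto
    qed auto
    then show False by (simp add: emeasure_ball unit_ball_vol_3)
  qed
  moreover have "mollifier_mass \<ge> 0" unfolding mollifier_mass_def by simp
  ultimately show ?thesis by simp
qed

text \<open>This serves both small and large radii. The limit is not asked at z = 0, because there
  the point x + r n z stays at x even when the radii tend to infinity; a single point is a null
  set.\<close>

lemma tendsto_mollify_dominated:
  assumes w: "continuous_on UNIV w" and pos: "\<And>n. r n > 0"
    and bound: "\<And>n z. z \<in> cball 0 1 \<Longrightarrow> norm (w (x + r n *\<^sub>R z)) \<le> M"
    and lim: "\<And>z. z \<noteq> 0 \<Longrightarrow> (\<lambda>n. w (x + r n *\<^sub>R z)) \<longlonglongrightarrow> l"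
  shows "(\<lambda>n. mollify (r n) x w) \<longlonglongrightarrow> mollifier_mass *\<^sub>R l"
proof -
  have [measurable]: "w \<in> borel_measurable borel"
    using w by (rule borel_measurable_continuous_onI)
  have "M \<ge> 0" using order_trans[OF norm_ge_zero bound[of 0 0]] by simp
  have "(\<lambda>n. \<integral>z. max 0 (1 - z \<bullet> z) *\<^sub>R w (x + r n *\<^sub>R z) \<partial>lborel)
      \<longlonglongrightarrow> (\<integral>z. max 0 (1 - z \<bullet> z) *\<^sub>R l \<partial>(lborel :: (real^3) measure))"
  proof (rule integral_dominated_convergence[where w = "\<lambda>z::real^3. M * indicator (cball 0 1) z"])
    have "AE z in lborel. z \<noteq> (0::real^3)" by (rule AE_lborel_singleton)
    then show "AE z in lborel. (\<lambda>n. max 0 (1 - z \<bullet> z) *\<^sub>R w (x + r n *\<^sub>R z)) \<longlonglongrightarrow> max 0 (1 - z \<bullet> z) *\<^sub>R l"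
      by (rule AE_mp) (intro AE_I2 impI tendsto_scaleR tendsto_const lim)
    show "AE z in lborel. norm (max 0 (1 - z \<bullet> z) *\<^sub>R w (x + r n *\<^sub>R z)) \<le> M * indicator (cball 0 1) z" for n
    proof (rule AE_I2)
      fix z :: "real^3"
      show "norm (max 0 (1 - z \<bullet> z) *\<^sub>R w (x + r n *\<^sub>R z)) \<le> M * indicator (cball 0 1) z"
      proof (cases "z \<in> cball 0 1")
        case True
        have "norm (max 0 (1 - z \<bullet> z) *\<^sub>R w (x + r n *\<^sub>R z)) \<le> 1 * M"
          unfolding norm_scaleR using True max_0_le_indicator[of z] bound[OF True] by (intro mult_mono) auto
        then show ?thesis using True by simp
      next
        case False
        then have "max 0 (1 - z \<bullet> z) = 0" using max_0_le_indicator[of z] by simp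
        then show ?thesis using \<open>M \<ge> 0\<close> by simp
      qed
    qed
  qed (rule integrable_cball_indicator | simp)+
  moreover have "integrable lborel (\<lambda>z::real^3. max 0 (1 - z \<bullet> z))"
    by (rule integrable_max_0_one_minus)
  ultimately show ?thesis
    by (simp add: mollify_rescaled[OF w pos] mollifier_mass_def)
qed

text \<open>Radii at most 1 keep all sampled points in the compact ball of radius 1 about x, where w
  is bounded; pointwise convergence is continuity at x.\<close>

lemma tendsto_mollify_0:
  assumes w: "continuous_on UNIV w" and pos: "\<And>n. r n > 0" and "r \<longlonglongrightarrow> 0" "\<And>n. r n \<le> 1"
  shows "(\<lambda>n. mollify (r n) x w) \<longlonglongrightarrow> mollifier_mass *\<^sub>R w x"
proof -
  have "bounded (w ` cball x 1)"
    by (intro compact_imp_bounded compact_continuous_image continuous_on_subset[OF w]) auto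
  then obtain M where M: "\<forall>y\<in>cball x 1. norm (w y) \<le> M" unfolding bounded_iff by auto
  show ?thesis
  proof (rule tendsto_mollify_dominated[OF w pos])
    fix z :: "real^3" and n
    assume "z \<in> cball 0 1"
    then have "r n * norm z \<le> 1 * 1" using pos[of n] assms(4) by (intro mult_mono) auto
    then have "x + r n *\<^sub>R z \<in> cball x 1" using pos[of n] by (simp add: dist_norm)
    then show "norm (w (x + r n *\<^sub>R z)) \<le> M" using M by blast
  next
    fix z :: "real^3"
    have "(\<lambda>n. x + r n *\<^sub>R z) \<longlonglongrightarrow> x + 0 *\<^sub>R z"
      by (intro tendsto_intros assms)
    then have "(\<lambda>n. w (x + r n *\<^sub>R z)) \<longlonglongrightarrow> w (x + 0 *\<^sub>R z)"
      by (rule continuous_on_tendsto_compose[OF w]) auto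
    then show "(\<lambda>n. w (x + r n *\<^sub>R z)) \<longlonglongrightarrow> w x" by simp
  qed
qed

lemma continuous_tendsto_0_bounded:
  fixes w :: "'a::euclidean_space \<Rightarrow> 'b::real_normed_vector"
  assumes w: "continuous_on UNIV w" and lim: "(w \<longlongrightarrow> 0) at_infinity"
  obtains M where "M \<ge> 0" "\<And>y. norm (w y) \<le> M"
proof -
  have "\<forall>\<^sub>F y in at_infinity. norm (w y) < 1"
    using tendstoD[OF lim, of 1] by simp
  then obtain b where b: "\<And>y. b \<le> norm y \<Longrightarrow> norm (w y) < 1"
    unfolding eventually_at_infinity by auto
  have "bounded (w ` cball 0 b)"
    by (intro compact_imp_bounded compact_continuous_image continuous_on_subset[OF w]) auto
  then obtain M where M: "\<forall>y\<in>cball 0 b. norm (w y) \<le> M" unfolding bounded_iff by auto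
  show thesis
  proof (rule that)
    show "norm (w y) \<le> max 1 M" for y
      using b[of y] M by (cases "b \<le> norm y") (auto simp: le_max_iff_disj)
  qed auto
qed

text \<open>For fixed nonzero z the point x + r z has norm at least r |z| - |x|, so it escapes to
  infinity, where w tends to 0.\<close>

lemma tendsto_mollify_at_top:
  assumes w: "continuous_on UNIV w" and lim: "(w \<longlongrightarrow> 0) at_infinity"
    and pos: "\<And>n. r n > 0" and r: "filterlim r at_top sequentially"
  shows "(\<lambda>n. mollify (r n) x w) \<longlonglongrightarrow> 0"
proof -
  obtain M where M: "M \<ge> 0" "\<And>y. norm (w y) \<le> M"
    using continuous_tendsto_0_bounded[OF w lim] by blast
  have "(\<lambda>n. mollify (r n) x w) \<longlonglongrightarrow> mollifier_mass *\<^sub>R 0"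
  proof (rule tendsto_mollify_dominated[OF w pos])
    fix z :: "real^3" assume "z \<noteq> 0"
    have "filterlim (\<lambda>n. - norm x + norm z * r n) at_top sequentially"
      by (intro filterlim_tendsto_add_at_top[OF tendsto_const] filterlim_tendsto_pos_mult_at_top[OF tendsto_const _ r])
         (use \<open>z \<noteq> 0\<close> in auto)
    then have "filterlim (\<lambda>n. norm (x + r n *\<^sub>R z)) at_top sequentially"
    proof (rule filterlim_at_top_mono, intro always_eventually allI)
      show "- norm x + norm z * r n \<le> norm (x + r n *\<^sub>R z)" for n
        using norm_diff_ineq[of "r n *\<^sub>R z" x] pos[of n] by (simp add: mult.commute add.commute)
    qed
    then have "filterlim (\<lambda>n. x + r n *\<^sub>R z) at_infinity sequentially"
      by (simp add: filterlim_at_infinity_conv_norm_at_top)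
    then show "(\<lambda>n. w (x + r n *\<^sub>R z)) \<longlonglongrightarrow> 0"
      by (rule filterlim_compose[OF lim])
  qed (rule M)
  then show ?thesis by simp
qed

text \<open>Where the mollifier is nonzero, |y - x| < r and so 1 / r^3 is at most 1 / (r |y - x|^2).
  The average is thus at most 1 / r times a fixed integral. This version serves the vorticity, for
  which no pointwise decay is assumed.\<close>

lemma tendsto_mollify_at_top_integrable:
  assumes w: "continuous_on UNIV w" and int: "integrable lborel (\<lambda>y. norm (w y) / norm (y - x) ^ 2)"
    and pos: "\<And>n. r n > 0" and r: "filterlim r at_top sequentially"
  shows "(\<lambda>n. mollify (r n) x w) \<longlonglongrightarrow> 0"
proof (rule tendsto_norm_zero_cancel, rule tendsto_sandwich[OF _ _ tendsto_const])
  have [measurable]: "w \<in> borel_measurable borel"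
    using w by (rule borel_measurable_continuous_onI)
  let ?I = "\<integral>y. norm (w y) / norm (y - x) ^ 2 \<partial>lborel"
  have "(\<lambda>n. inverse (r n) * ?I) \<longlonglongrightarrow> 0 * ?I"
    by (intro tendsto_mult tendsto_const tendsto_inverse_0_at_top r)
  then show "(\<lambda>n. inverse (r n) * ?I) \<longlonglongrightarrow> 0" by simp
  show "\<forall>\<^sub>F n in sequentially. norm (mollify (r n) x w) \<le> inverse (r n) * ?I"
  proof (intro always_eventually allI)
    fix n
    have "norm (mollify (r n) x w) \<le> (\<integral>y. inverse (r n) * (norm (w y) / norm (y - x) ^ 2) \<partial>lborel)"
      unfolding mollify_def
    proof (rule order_trans[OF integral_norm_bound integral_mono_AE'])
      have "norm (mollifier (r n) ((y - x) \<bullet> (y - x)) *\<^sub>R w y) \<le> inverse (r n) * (norm (w y) / norm (y - x) ^ 2)"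
        if "y \<noteq> x" for y
      proof -
        let ?s = "(y - x) \<bullet> (y - x)"
        have s: "?s > 0" using that by simp
        have "mollifier (r n) ?s \<le> inverse (r n) / ?s"
        proof (cases "?s < (r n)\<^sup>2")
          case True
          have "mollifier (r n) ?s \<le> 1 / (r n) ^ 3"
            unfolding mollifier_def using s pos[of n] by (intro divide_right_mono) auto
          also have "\<dots> = inverse (r n) / (r n)\<^sup>2" by (simp add: divide_inverse power2_eq_square power3_eq_cube)
          also have "\<dots> \<le> inverse (r n) / ?s"
            using True s pos[of n] by (intro divide_left_mono) auto
          finally show ?thesis .
        next
          case False
          then have "mollifier (r n) ?s = 0" using pos[of n] by (simp add: mollifier_def max_def)
          then show ?thesis using s pos[of n] by (simp add: less_imp_le)
        qed
        moreover have "0 \<le> mollifier (r n) ?s" using pos[of n] by (simp add: mollifier_def)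
        ultimately show ?thesis
          using mult_right_mono[of "mollifier (r n) ?s" "inverse (r n) / ?s" "norm (w y)"]
          by (simp add: power2_norm_eq_inner)
      qed
      then show "AE y in lborel. norm (mollifier (r n) ((y - x) \<bullet> (y - x)) *\<^sub>R w y) \<le> inverse (r n) * (norm (w y) / norm (y - x) ^ 2)"
        by (intro AE_mp[OF AE_lborel_singleton[of x] AE_I2] impI)
    next
      show "integrable lborel (\<lambda>y. inverse (r n) * (norm (w y) / norm (y - x) ^ 2))"
        by (intro integrable_mult_right int)
    qed (use pos[of n] in auto)
    then show "norm (mollify (r n) x w) \<le> inverse (r n) * ?I" by (simp only: integral_mult_right_zero)
  qed
qed (auto intro: always_eventually)

subsection \<open>The smoothed Newton kernel\<close>

text \<open>The Newton kernel \<open>y / |y|\<^sup>3\<close> smoothed inside the unit ball, as a function of \<open>s = |y|\<^sup>2\<close>;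
  the quadratic polynomial potential is chosen so that the field is continuously differentiable.\<close>

definition newton :: "real \<Rightarrow> real" where
  "newton s = (if s \<in> {1..} then s powr (- 3 / 2) else (5 - 3 * s) / 2)"

definition newton' :: "real \<Rightarrow> real" where
  "newton' s = (if s \<in> {1..} then - 3 / 2 * s powr (- 5 / 2) else - 3 / 2)"

text \<open>The branches match to first order at s = 1: both have value 1 and slope -3/2.\<close>

lemma has_real_derivative_newton: "(newton has_real_derivative newton' s) (at s)"
proof -
  have cl: "closure {..<1::real} = {..1}" by simp
  have "(newton has_vector_derivative (if s \<in> {1..} then - 3 / 2 * s powr (- 5 / 2) else - 3 / 2))
      (at s within UNIV)"
    unfolding newton_def[abs_def]
  proof (rule has_vector_derivative_If_within_closures[where T = "{..<1}"])
    assume "s \<in> {1..} \<union> (closure {1..} \<inter> closure {..<1})"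
    then have "s > 0" by (auto simp: cl)
    then show "((\<lambda>s. s powr (- 3 / 2)) has_vector_derivative - 3 / 2 * s powr (- 5 / 2))
        (at s within {1..} \<union> (closure {1..} \<inter> closure {..<1}))"
      unfolding has_real_derivative_iff_has_vector_derivative[symmetric]
      by (auto intro!: derivative_eq_intros)
  next
    show "((\<lambda>s. (5 - 3 * s) / 2) has_vector_derivative - 3 / 2)
        (at s within {..<1} \<union> (closure {1..} \<inter> closure {..<1}))"
      unfolding has_real_derivative_iff_has_vector_derivative[symmetric]
      by (auto intro!: derivative_eq_intros)
  next
    assume "s \<in> closure {1..}" "s \<in> closure {..<1}"
    then have "s = 1" by (simp add: cl)
    then show "s powr (- 3 / 2) = (5 - 3 * s) / 2" "- 3 / 2 * s powr (- 5 / 2) = - 3 / 2"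
      by simp_all
  qed auto
  then show ?thesis
    by (simp add: has_real_derivative_iff_has_vector_derivative newton'_def)
qed

lemma continuous_on_newton': "continuous_on A newton'"
proof -
  \<comment> \<open>Replacing s by max 1 s merges the branches and keeps the base of the power away
    from 0.\<close>
  have *: "newton' = (\<lambda>s. - 3 / 2 * (max 1 s) powr (- 5 / 2))"
    by (auto simp: newton'_def fun_eq_iff max_def)
  show ?thesis unfolding * by (intro continuous_intros) (auto simp: max_def)
qed

lemma newton_nonneg: "newton s \<ge> 0"
  by (simp add: newton_def)

lemma newton_le: "s \<ge> 0 \<Longrightarrow> newton s \<le> 5 / 2"
  using powr_mono2'[of "- 3 / 2" 1 s] by (cases "s \<ge> 1") (simp_all add: newton_def)

lemma newton_le_powr:
  assumes "s > 0" shows "newton s \<le> 5 / 2 * s powr (- 3 / 2)"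
proof (cases "s \<ge> 1")
  case False
  then have "1 \<le> s powr (- 3 / 2)" using powr_mono2'[of "- 3 / 2" s 1] assms by simp
  then show ?thesis using False newton_le[of s] assms by simp
qed (simp add: newton_def)

text \<open>The left side is the divergence of the field B(|y|^2) y in dimension 3, with B =
  \<open>newton\<close> and s = |y|^2. Outside the unit ball the Newton field is solenoidal; inside,
  the quadratic potential yields 15/2 * (1 - s).\<close>

lemma newton_divergence: "3 * newton s + 2 * s * newton' s = 15 / 2 * max 0 (1 - s)"
proof (cases "s \<ge> 1")
  case True
  then have "s * s powr (- 5 / 2) = s powr (- 3 / 2)"
    using powr_add[of s 1 "- 5 / 2"] by simp
  then show ?thesis using True by (simp add: newton_def newton'_def mult.left_commute)
qed (simp add: newton_def newton'_def max_def field_simps)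

text \<open>The kernel s^(-3/2) is invariant under this scaling, so r only sets the radius of the
  smoothed region.\<close>

definition newton_scaled :: "real \<Rightarrow> real \<Rightarrow> real" where
  "newton_scaled r s = newton (s / r\<^sup>2) / r ^ 3"

lemma has_real_derivative_newton_scaled:
  "(newton_scaled r has_real_derivative newton' (s / r\<^sup>2) / r ^ 5) (at s)"
proof -
  have "((\<lambda>s. newton (s / r\<^sup>2)) has_real_derivative newton' (s / r\<^sup>2) * (1 / r\<^sup>2)) (at s)"
    by (rule DERIV_chain'[OF DERIV_cdivide[OF DERIV_ident] has_real_derivative_newton])
  moreover have "r ^ 5 = r\<^sup>2 * r ^ 3" by (simp flip: power_add)
  ultimately show ?thesis
    using DERIV_cdivide[of "\<lambda>s. newton (s / r\<^sup>2)" "newton' (s / r\<^sup>2) * (1 / r\<^sup>2)" s UNIV "r ^ 3"]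
    by (simp add: newton_scaled_def[abs_def])
qed

lemma newton_scaled_divergence:
  "3 * newton_scaled r s + 2 * (newton' (s / r\<^sup>2) / r ^ 5) * s = 15 / 2 * mollifier r s"
proof -
  have r5: "r ^ 5 = r\<^sup>2 * r ^ 3" by (simp flip: power_add)
  have "3 * newton_scaled r s + 2 * (newton' (s / r\<^sup>2) / r ^ 5) * s =
      (3 * newton (s / r\<^sup>2) + 2 * (s / r\<^sup>2) * newton' (s / r\<^sup>2)) / r ^ 3"
    unfolding newton_scaled_def r5 by (simp add: add_divide_distrib)
  also have "\<dots> = 15 / 2 * mollifier r s"
    using newton_divergence[of "s / r\<^sup>2"] by (simp only: mollifier_def times_divide_eq_right)
  finally show ?thesis .
qed

lemma powr_minus_3_2_scale:
  fixes r s :: real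
  assumes "r > 0" "s > 0"
  shows "(s / r\<^sup>2) powr (- 3 / 2) / r ^ 3 = s powr (- 3 / 2)"
proof -
  have "(r\<^sup>2) powr (- 3 / 2) = (r powr 2) powr (- 3 / 2)" using assms by (simp add: powr_numeral)
  also have "\<dots> = r powr (- 3)" by (simp only: powr_powr) simp
  also have "\<dots> = 1 / r ^ 3" using assms by (simp add: powr_minus powr_numeral divide_inverse)
  finally show ?thesis using assms by (simp add: powr_divide)
qed

lemma newton_scaled_outside: "r > 0 \<Longrightarrow> r\<^sup>2 \<le> s \<Longrightarrow> newton_scaled r s = s powr (- 3 / 2)"
  using powr_minus_3_2_scale[of r s] less_le_trans[OF zero_less_power[of r 2], of s]
  by (simp add: newton_scaled_def newton_def le_divide_eq)

text \<open>The bound does not depend on r, which makes it usable for domination over all scales.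
  The constant 5/2 is the value of \<open>newton\<close> at 0.\<close>

lemma newton_scaled_le_powr:
  assumes "r > 0" "s > 0"
  shows "newton_scaled r s \<le> 5 / 2 * s powr (- 3 / 2)"
proof -
  have "newton_scaled r s \<le> 5 / 2 * (s / r\<^sup>2) powr (- 3 / 2) / r ^ 3"
    unfolding newton_scaled_def using assms by (intro divide_right_mono newton_le_powr) auto
  also have "\<dots> = 5 / 2 * s powr (- 3 / 2)"
    by (subst powr_minus_3_2_scale[OF assms, symmetric]) simp
  finally show ?thesis .
qed

lemma newton_scaled_nonneg: "r > 0 \<Longrightarrow> newton_scaled r s \<ge> 0"
  by (simp add: newton_scaled_def newton_nonneg)

lemma newton_scaled_le: "r > 0 \<Longrightarrow> s \<ge> 0 \<Longrightarrow> newton_scaled r s \<le> 5 / 2 / r ^ 3"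
  unfolding newton_scaled_def by (intro divide_right_mono newton_le) auto

lemma powr_minus_3_2_inner: "(z \<bullet> z) powr (- 3 / 2) = 1 / norm z ^ 3"
proof (cases "z = 0")
  case False
  have "(z \<bullet> z) powr (- 3 / 2) = (norm z powr 2) powr (- 3 / 2)"
    using False by (simp add: powr_numeral power2_norm_eq_inner)
  also have "\<dots> = norm z powr (- 3)" by (simp only: powr_powr) simp
  also have "\<dots> = 1 / norm z ^ 3" using False by (simp add: powr_minus powr_numeral divide_inverse)
  finally show ?thesis .
qed simp

text \<open>The gradient of the difference of two smoothed Newton potentials, at scales \<open>1/(n+1)\<close> and
  \<open>n+1\<close>. Both potentials have the same gradient outside the larger ball, so no cut-off is needed.\<close>

definition newton_field :: "nat \<Rightarrow> real^3 \<Rightarrow> real^3 \<Rightarrow> real^3" where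
  "newton_field n x y = - ((newton_scaled (inverse (Suc n)) ((y - x) \<bullet> (y - x))
      - newton_scaled (Suc n) ((y - x) \<bullet> (y - x))) *\<^sub>R (y - x))"

text \<open>The field is radial in the sense of \<open>C1_radial_field\<close>, with profile the
  difference of the two scaled kernels. The outer minus sign makes the large-scale mollifier appear
  positively in the divergence.\<close>

lemma
  shows C1_newton_field: "C1 (newton_field n x)"
    and newton_field_symmetric: "partial i (newton_field n x) y $ j = partial j (newton_field n x) y $ i"
    and divergence_newton_field: "divergence (newton_field n x) y = 15 / 2 *
      (mollifier (Suc n) ((y - x) \<bullet> (y - x)) - mollifier (inverse (Suc n)) ((y - x) \<bullet> (y - x)))"
proof -
  let ?a = "inverse (real (Suc n))" and ?b = "real (Suc n)"
  let ?B = "\<lambda>s. newton_scaled ?a s - newton_scaled ?b s"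
  let ?B' = "\<lambda>s. newton' (s / ?a\<^sup>2) / ?a ^ 5 - newton' (s / ?b\<^sup>2) / ?b ^ 5"
  have B: "(?B has_real_derivative ?B' s) (at s)" for s
    by (intro DERIV_diff has_real_derivative_newton_scaled)
  have B': "continuous_on UNIV ?B'"
    unfolding divide_inverse
    by (intro continuous_on_diff continuous_on_mult_right continuous_on_id
        continuous_on_compose2[OF continuous_on_newton'[of UNIV]] subset_UNIV)
  show "C1 (newton_field n x)"
    unfolding newton_field_def[abs_def] by (rule C1_radial_field[OF B B'])
  have p: "partial i (newton_field n x) y $ j = - (?B ((y - x) \<bullet> (y - x)) * (if i = j then 1 else 0)
        + 2 * ?B' ((y - x) \<bullet> (y - x)) * (y - x) $ i * (y - x) $ j)" for i j
    unfolding newton_field_def[abs_def] by (rule partial_radial_field[OF B B'])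
  show "partial i (newton_field n x) y $ j = partial j (newton_field n x) y $ i"
    unfolding p by (cases "i = j"; cases "j = i") (simp_all only: mult_ac if_False)
  let ?s = "(y - x) \<bullet> (y - x)"
  have "divergence (newton_field n x) y = - (3 * ?B ?s + 2 * ?B' ?s * ?s)"
  proof -
    \<comment> \<open>The trace of the derivative matrix: the three diagonal entries add up to 3
      times the profile plus 2 |y - x|^2 times its derivative, negated.\<close>
    have "- (\<beta> * 1 + 2 * \<gamma> * a * a) + - (\<beta> * 1 + 2 * \<gamma> * b * b) + - (\<beta> * 1 + 2 * \<gamma> * c * c) =
        - (3 * \<beta> + 2 * \<gamma> * (a * a + b * b + c * c))" for \<beta> \<gamma> a b c :: real
      by (simp add: algebra_simps)
    then show ?thesis
      unfolding divergence_def p sum_3 by (simp only: refl if_True inner_vec_def sum_3 inner_real_def)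
  qed
  also have "3 * ?B ?s + 2 * ?B' ?s * ?s = 15 / 2 * mollifier ?a ?s - 15 / 2 * mollifier ?b ?s"
  proof -
    have "3 * (a - b) + 2 * (c - d) * s = (3 * a + 2 * c * s) - (3 * b + 2 * d * s)" for a b c d s :: real
      by (simp add: algebra_simps)
    then show ?thesis unfolding newton_scaled_divergence[symmetric] .
  qed
  finally show "divergence (newton_field n x) y = 15 / 2 * (mollifier ?b ?s - mollifier ?a ?s)"
    by (simp only: right_diff_distrib minus_diff_eq)
qed

lemma newton_field_compact_support:
  assumes "y \<notin> cball x (Suc n)" shows "newton_field n x y = 0"
proof -
  let ?s = "(y - x) \<bullet> (y - x)"
  have "real (Suc n) \<le> norm (y - x)" using assms by (simp add: dist_norm norm_minus_commute)
  then have 1: "(real (Suc n))\<^sup>2 \<le> ?s"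
    unfolding power2_norm_eq_inner[symmetric] by (intro power_mono) auto
  have "(inverse (real (Suc n)))\<^sup>2 \<le> 1\<^sup>2"
    by (intro power_mono) (auto simp: inverse_le_1_iff simp del: of_nat_Suc)
  also have "1\<^sup>2 \<le> (real (Suc n))\<^sup>2" by (intro power_mono) auto
  also note 1
  finally have 2: "(inverse (real (Suc n)))\<^sup>2 \<le> ?s" .
  show ?thesis
    unfolding newton_field_def
    by (simp only: newton_scaled_outside[OF _ 1] newton_scaled_outside[OF _ 2] of_nat_0_less_iff
        positive_imp_inverse_positive zero_less_Suc) simp
qed

lemma norm_newton_field_le:
  assumes "y \<noteq> x" shows "norm (newton_field n x y) \<le> 5 / 2 / norm (y - x) ^ 2"
proof -
  let ?s = "(y - x) \<bullet> (y - x)"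
  have s: "?s > 0" using assms by simp
  \<comment> \<open>Both kernels lie between 0 and the same bound, so their difference obeys it
    without a factor 2.\<close>
  have "\<bar>newton_scaled (inverse (Suc n)) ?s - newton_scaled (Suc n) ?s\<bar> \<le> 5 / 2 * ?s powr (- 3 / 2)"
  proof -
    have pos: "0 < inverse (real (Suc n))" "0 < real (Suc n)" by simp_all
    show ?thesis
      using newton_scaled_le_powr[OF pos(1) s] newton_scaled_nonneg[OF pos(1), of ?s]
        newton_scaled_le_powr[OF pos(2) s] newton_scaled_nonneg[OF pos(2), of ?s] by linarith
  qed
  then have "norm (newton_field n x y) \<le> 5 / 2 * (1 / norm (y - x) ^ 3) * norm (y - x)"
    unfolding newton_field_def norm_minus_cancel norm_scaleR powr_minus_3_2_inner
    by (intro mult_right_mono) auto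
  also have "\<dots> = 5 / 2 / norm (y - x) ^ 2"
    using assms by (simp add: power2_eq_square power3_eq_cube)
  finally show ?thesis .
qed

text \<open>For fixed y the inner radius eventually falls below |y - x|, where the inner kernel is
  exactly Newtonian, while the outer kernel is at most 5/2 / (n+1)^3.\<close>

lemma tendsto_newton_field:
  assumes "y \<noteq> x"
  shows "(\<lambda>n. newton_field n x y) \<longlonglongrightarrow> - ((1 / norm (y - x) ^ 3) *\<^sub>R (y - x))"
proof -
  let ?s = "(y - x) \<bullet> (y - x)"
  have s: "?s > 0" using assms by simp
  have a: "(\<lambda>n. newton_scaled (inverse (Suc n)) ?s) \<longlonglongrightarrow> 1 / norm (y - x) ^ 3"
  proof (rule tendsto_eventually)
    have "(\<lambda>n. (inverse (real (Suc n)))\<^sup>2) \<longlonglongrightarrow> 0"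
      using tendsto_power[OF LIMSEQ_inverse_real_of_nat, of 2] by simp
    from order_tendstoD(2)[OF this s]
    have "\<forall>\<^sub>F n in sequentially. (inverse (real (Suc n)))\<^sup>2 < ?s" .
    then show "\<forall>\<^sub>F n in sequentially. newton_scaled (inverse (Suc n)) ?s = 1 / norm (y - x) ^ 3"
    proof eventually_elim
      fix n assume "(inverse (real (Suc n)))\<^sup>2 < ?s"
      then have "newton_scaled (inverse (Suc n)) ?s = ?s powr (- 3 / 2)"
        by (intro newton_scaled_outside less_imp_le) simp_all
      then show "newton_scaled (inverse (Suc n)) ?s = 1 / norm (y - x) ^ 3"
        by (simp only: powr_minus_3_2_inner)
    qed
  qed
  have b: "(\<lambda>n. newton_scaled (Suc n) ?s) \<longlonglongrightarrow> 0"
  proof (rule tendsto_sandwich[OF _ _ tendsto_const])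
    have "(\<lambda>n. 5 / 2 * (inverse (real (Suc n))) ^ 3) \<longlonglongrightarrow> 5 / 2 * 0 ^ 3"
      by (intro tendsto_mult tendsto_const tendsto_power LIMSEQ_inverse_real_of_nat)
    then show "(\<lambda>n. 5 / 2 * (inverse (real (Suc n))) ^ 3) \<longlonglongrightarrow> 0" by simp
    show "\<forall>\<^sub>F n in sequentially. newton_scaled (Suc n) ?s \<le> 5 / 2 * (inverse (real (Suc n))) ^ 3"
    proof (intro always_eventually allI)
      fix n
      have "newton_scaled (Suc n) ?s \<le> 5 / 2 / real (Suc n) ^ 3"
        by (rule newton_scaled_le) auto
      then show "newton_scaled (Suc n) ?s \<le> 5 / 2 * (inverse (real (Suc n))) ^ 3"
        by (simp only: divide_inverse power_inverse)
    qed
    show "\<forall>\<^sub>F n in sequentially. 0 \<le> newton_scaled (Suc n) ?s"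
      by (intro always_eventually allI newton_scaled_nonneg) simp
  qed
  show ?thesis
    unfolding newton_field_def
    using tendsto_minus[OF tendsto_scaleR[OF tendsto_diff[OF a b] tendsto_const]] by (simp only: diff_zero)
qed

subsection \<open>The Biot--Savart law\<close>

lemma norm_cross3_le: "norm (cross3 a b) \<le> norm a * norm b"
proof -
  have "(norm (cross3 a b))\<^sup>2 \<le> (norm a * norm b)\<^sup>2"
    by (simp add: norm_cross power_mult_distrib)
  then show ?thesis by (rule power2_le_imp_le) simp
qed

lemma borel_measurable_cross3 [measurable (raw)]:
  assumes [measurable]: "f \<in> borel_measurable M" "g \<in> borel_measurable M"
  shows "(\<lambda>x. cross3 (f x) (g x)) \<in> borel_measurable M"
proof -
  have "continuous_on UNIV (\<lambda>p::(real^3) \<times> (real^3). cross3 (fst p) (snd p))"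
    by (intro continuous_on_cross3 continuous_intros)
  from borel_measurable_continuous_on[OF this, of "\<lambda>x. (f x, g x)" M]
  show ?thesis by simp
qed

text \<open>The pole x comes first and the factor 1 / (4 pi) is left out, so that the same kernel
  describes \<open>Phi\<close> as a function of either variable. At y = x the value is 0.\<close>

definition biot_savart :: "real^3 \<Rightarrow> (real^3 \<Rightarrow> real^3) \<Rightarrow> real^3 \<Rightarrow> real^3" where
  "biot_savart x G y = (1 / norm (y - x) ^ 3) *\<^sub>R cross3 (y - x) (G y)"

lemma integrable_biot_savart:
  assumes G: "continuous_on UNIV G" and int: "integrable lborel (\<lambda>y. norm (G y) / norm (y - x) ^ 2)"
  shows "integrable lborel (biot_savart x G)"
proof (rule Bochner_Integration.integrable_bound[OF int])
  have [measurable]: "G \<in> borel_measurable borel"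
    using G by (rule borel_measurable_continuous_onI)
  show "biot_savart x G \<in> borel_measurable lborel"
    unfolding biot_savart_def[abs_def] by measurable
  show "AE y in lborel. norm (biot_savart x G y) \<le> norm (norm (G y) / norm (y - x) ^ 2)"
  proof (rule AE_I2)
    fix y
    have "norm (biot_savart x G y) \<le> 1 / norm (y - x) ^ 3 * (norm (y - x) * norm (G y))"
      unfolding biot_savart_def norm_scaleR using norm_cross3_le[of "y - x" "G y"]
      by (intro mult_mono) auto
    also have "\<dots> \<le> norm (G y) / norm (y - x) ^ 2"
      by (simp add: power2_eq_square power3_eq_cube)
    finally show "norm (biot_savart x G y) \<le> norm (norm (G y) / norm (y - x) ^ 2)" by simp
  qed
qed

lemma continuous_on_mollifier: "continuous_on A f \<Longrightarrow> continuous_on A (\<lambda>y. mollifier r (f y))"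
  unfolding mollifier_def divide_inverse by (intro continuous_intros)

lemma integrable_mollifier_scaleR:
  assumes w: "continuous_on UNIV w" and r: "r > 0"
  shows "integrable lborel (\<lambda>y. mollifier r ((y - x) \<bullet> (y - x)) *\<^sub>R (w y :: real^3))"
proof (rule integrable_compact_support)
  show "continuous_on UNIV (\<lambda>y. mollifier r ((y - x) \<bullet> (y - x)) *\<^sub>R w y)"
    by (intro continuous_on_scaleR continuous_on_mollifier continuous_intros w)
  fix y assume "y \<notin> cball x r"
  then have "r\<^sup>2 \<le> (y - x) \<bullet> (y - x)"
    unfolding power2_norm_eq_inner[symmetric] using r
    by (intro power_mono) (auto simp: dist_norm norm_minus_commute)
  then have "mollifier r ((y - x) \<bullet> (y - x)) = 0"
    using r by (simp add: mollifier_def max_def)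
  then show "mollifier r ((y - x) \<bullet> (y - x)) *\<^sub>R w y = 0" by simp
qed

text \<open>The constant is \<open>4\<pi>\<close>; only its positivity matters, so it is never computed.\<close>

lemma integral_biot_savart:
  assumes w: "C1 w" and div: "\<And>y. divergence w y = 0"
    and curl: "\<And>y. curl w y = G y - gradient Q y" and Q: "C1 Q"
    and G: "continuous_on UNIV G" and int: "integrable lborel (\<lambda>y. norm (G y) / norm (y - x) ^ 2)"
    and avg: "(\<lambda>n. mollify (Suc n) x w) \<longlonglongrightarrow> 0"
  shows "(\<integral>y. biot_savart x G y \<partial>lborel) = (15 / 2 * mollifier_mass) *\<^sub>R w x"
proof -
  let ?k = "\<lambda>n. newton_field n x"
  have [measurable]: "G \<in> borel_measurable borel"
    using G by (rule borel_measurable_continuous_onI)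
  have [measurable]: "?k n \<in> borel_measurable borel" for n
    by (rule borel_measurable_continuous_onI[OF C1_continuous[OF C1_newton_field]])
  have gradQ: "continuous_on UNIV (gradient Q)"
    unfolding gradient_def[abs_def] by (intro continuous_on_vec_lambda C1_continuous_partial Q)
  note w_cont = C1_continuous[OF w, of UNIV]
  \<comment> \<open>Testing w against the divergence of the field compares its averages at the two
    scales.\<close>
  have lhs: "(\<integral>y. divergence (?k n) y *\<^sub>R w y \<partial>lborel) =
      (15 / 2) *\<^sub>R (mollify (Suc n) x w - mollify (inverse (Suc n)) x w)" for n
  proof -
    have "(\<integral>y. divergence (?k n) y *\<^sub>R w y \<partial>lborel) =
        (\<integral>y. (15 / 2) *\<^sub>R (mollifier (Suc n) ((y - x) \<bullet> (y - x)) *\<^sub>R w y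
          - mollifier (inverse (Suc n)) ((y - x) \<bullet> (y - x)) *\<^sub>R w y) \<partial>lborel)"
      unfolding divergence_newton_field by (simp only: scaleR_scaleR[symmetric] scaleR_diff_left)
    also have "\<dots> = (15 / 2) *\<^sub>R (mollify (Suc n) x w - mollify (inverse (Suc n)) x w)"
      unfolding mollify_def integral_scaleR_right
      by (subst Bochner_Integration.integral_diff) (simp_all add: integrable_mollifier_scaleR w_cont del: of_nat_Suc)
    finally show ?thesis .
  qed
  \<comment> \<open>After integration by parts the gradient part of curl w drops out, because the
    field is curl-free.\<close>
  have rhs: "(\<integral>y. divergence (?k n) y *\<^sub>R w y \<partial>lborel) = (\<integral>y. cross3 (?k n y) (G y) \<partial>lborel)" for n
  proof -
    have int_k: "integrable lborel (\<lambda>y. cross3 (?k n y) (H y))" if "continuous_on UNIV H" for H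
      by (rule integrable_compact_support[where x = x and R = "Suc n"])
         (use that in \<open>simp_all add: continuous_on_cross3 C1_continuous C1_newton_field newton_field_compact_support del: of_nat_Suc\<close>)
    have "(\<integral>y. divergence (?k n) y *\<^sub>R w y \<partial>lborel) = (\<integral>y. cross3 (?k n y) (curl w y) \<partial>lborel)"
      by (rule integral_divergence_scaleR[OF C1_newton_field newton_field_compact_support newton_field_symmetric w div])
    also have "\<dots> = (\<integral>y. cross3 (?k n y) (G y) - cross3 (?k n y) (gradient Q y) \<partial>lborel)"
      unfolding curl by (simp add: cross_minus_right right_diff_distrib Cross3.right_diff_distrib)
    also have "\<dots> = (\<integral>y. cross3 (?k n y) (G y) \<partial>lborel) - (\<integral>y. cross3 (?k n y) (gradient Q y) \<partial>lborel)"
      by (intro Bochner_Integration.integral_diff int_k G gradQ)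
    also have "(\<integral>y. cross3 (?k n y) (gradient Q y) \<partial>lborel) = 0"
      by (rule integral_cross3_gradient_eq_0[OF C1_newton_field newton_field_compact_support newton_field_symmetric Q])
    finally show ?thesis by simp
  qed
  \<comment> \<open>The fields converge to minus the Newton kernel, which accounts for the sign; the
    bound on them is uniform in n.\<close>
  have "(\<lambda>n. \<integral>y. cross3 (?k n y) (G y) \<partial>lborel) \<longlonglongrightarrow> (\<integral>y. - biot_savart x G y \<partial>lborel)"
  proof (rule integral_dominated_convergence[where w = "\<lambda>y. 5 / 2 * (norm (G y) / norm (y - x) ^ 2)"])
    show "(\<lambda>y. - biot_savart x G y) \<in> borel_measurable lborel"
      using integrable_biot_savart[OF G int] by measurable
    show "integrable lborel (\<lambda>y. 5 / 2 * (norm (G y) / norm (y - x) ^ 2))"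
      by (intro integrable_mult_right int)
    have ne: "AE y in lborel. y \<noteq> x" by (rule AE_lborel_singleton)
    show "AE y in lborel. (\<lambda>n. cross3 (?k n y) (G y)) \<longlonglongrightarrow> - biot_savart x G y"
    proof (rule AE_mp[OF ne AE_I2], rule impI)
      fix y assume "y \<noteq> x"
      have "(\<lambda>n. cross3 (?k n y) (G y)) \<longlonglongrightarrow> cross3 (- ((1 / norm (y - x) ^ 3) *\<^sub>R (y - x))) (G y)"
      proof -
        have "continuous_on UNIV (\<lambda>a. cross3 a (G y))"
          by (intro continuous_on_cross3 continuous_intros)
        from continuous_on_tendsto_compose[OF this tendsto_newton_field[OF \<open>y \<noteq> x\<close>]]
        show ?thesis by simp
      qed
      then show "(\<lambda>n. cross3 (?k n y) (G y)) \<longlonglongrightarrow> - biot_savart x G y"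
        by (simp add: biot_savart_def cross_mult_left)
    qed
    show "AE y in lborel. norm (cross3 (?k n y) (G y)) \<le> 5 / 2 * (norm (G y) / norm (y - x) ^ 2)" for n
    proof (rule AE_mp[OF ne AE_I2], rule impI)
      fix y assume "y \<noteq> x"
      have "norm (cross3 (?k n y) (G y)) \<le> 5 / 2 / norm (y - x) ^ 2 * norm (G y)"
        using norm_cross3_le mult_right_mono[OF norm_newton_field_le[OF \<open>y \<noteq> x\<close>] norm_ge_zero]
        by (rule order_trans)
      then show "norm (cross3 (?k n y) (G y)) \<le> 5 / 2 * (norm (G y) / norm (y - x) ^ 2)" by simp
    qed
  qed measurable
  \<comment> \<open>The average over radius n+1 tends to 0 by \<open>avg\<close>; the one over
    radius 1/(n+1) recovers w x up to the mass.\<close>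
  moreover have "(\<lambda>n. \<integral>y. cross3 (?k n y) (G y) \<partial>lborel) \<longlonglongrightarrow> (15 / 2) *\<^sub>R (0 - mollifier_mass *\<^sub>R w x)"
    unfolding rhs[symmetric] lhs
    by (intro tendsto_scaleR tendsto_diff tendsto_const avg tendsto_mollify_0[OF w_cont] LIMSEQ_inverse_real_of_nat)
       (auto simp: inverse_le_1_iff)
  ultimately have "(\<integral>y. - biot_savart x G y \<partial>lborel) = (15 / 2) *\<^sub>R (0 - mollifier_mass *\<^sub>R w x)"
    by (rule LIMSEQ_unique)
  then show ?thesis by simp
qed

subsection \<open>The vorticity of stationary Navier--Stokes flows\<close>

lemma C1_curl:
  assumes "\<And>i. C1 (partial i u)"
  shows "C1 (curl u)"
proof (rule C1_componentwise)
  show "C1 (\<lambda>x. curl u x $ k)" for k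
    using exhaust_3[of k] by (elim disjE; simp only: curl_nth) (intro C1_diff C1_nth assms)+
qed

lemma partial_curl:
  assumes "\<And>i. C1 (partial i u)"
  shows "partial j (curl u) y $ 1 = partial j (partial 2 u) y $ 3 - partial j (partial 3 u) y $ 2"
    and "partial j (curl u) y $ 2 = partial j (partial 3 u) y $ 1 - partial j (partial 1 u) y $ 3"
    and "partial j (curl u) y $ 3 = partial j (partial 1 u) y $ 2 - partial j (partial 2 u) y $ 1"
  by (simp_all only: partial_nth[OF C1_curl[OF assms], symmetric] curl_nth partial_diff C1_nth assms partial_nth)

lemma divergence_curl:
  assumes "C1 u" "\<And>i. C1 (partial i u)"
  shows "divergence (curl u) y = 0"
  unfolding divergence_def sum_3 partial_curl[OF assms(2)]
  using partial_commute[OF assms, of 1 2 y] partial_commute[OF assms, of 1 3 y]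
    partial_commute[OF assms, of 2 3 y] by simp

text \<open>In curl curl = grad div - Laplacian the gradient term vanishes: div u = 0 is
  differentiated in each direction and mixed partial derivatives are exchanged.\<close>

lemma curl_curl:
  assumes u: "C1 u" "\<And>i. C1 (partial i u)" and div: "\<And>y. divergence u y = 0"
  shows "curl (curl u) y = - laplacian u y"
proof -
  have "partial j (partial 1 u) y $ 1 + partial j (partial 2 u) y $ 2 + partial j (partial 3 u) y $ 3 = 0" for j
  proof -
    have "partial j (\<lambda>y. partial 1 u y $ 1 + partial 2 u y $ 2 + partial 3 u y $ 3) y = partial j (\<lambda>y. 0) y"
      using div by (simp add: divergence_def sum_3)
    also have "\<dots> = 0" by (simp add: partial_def)
    finally show ?thesis
      by (simp add: partial_add C1_add C1_nth u partial_nth)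
  qed
  note d = this[of 1] this[of 2] this[of 3]
  note c = partial_commute[OF u, of 2 1 y] partial_commute[OF u, of 3 1 y] partial_commute[OF u, of 3 2 y]
  show ?thesis
    unfolding vec_eq_iff forall_3 curl_nth partial_curl[OF u(2)] laplacian_def
    using d by (simp add: sum_3 c)
qed

text \<open>Q is the Bernoulli function p + |v|^2 / 2. The Lamb identity writes the advection term
  as grad (|v|^2 / 2) - v x curl v, so the equation turns into Laplacian v = grad Q - v x curl v,
  and \<open>curl_curl\<close> applies.\<close>

lemma curl_vorticity_navier_stokes:
  assumes ns: "smooth_stationary_navier_stokes v p"
  defines "Q \<equiv> \<lambda>y. p y + 1 / 2 * (v y $ 1 * v y $ 1 + v y $ 2 * v y $ 2 + v y $ 3 * v y $ 3)"
  shows "C1 Q" and "curl (curl v) y = cross3 (v y) (curl v y) - gradient Q y"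
proof -
  have v: "C1 v" "\<And>i. C1 (partial i v)" and p: "C1 p"
    using ns smooth_C1 smooth_partial unfolding smooth_stationary_navier_stokes_def by blast+
  note C1s = C1_add C1_cmult C1_mult C1_nth v(1) p
  show "C1 Q" unfolding Q_def by (intro C1s)
  have gradQ: "gradient Q y $ j = partial j p y +
      (v y $ 1 * partial j v y $ 1 + v y $ 2 * partial j v y $ 2 + v y $ 3 * partial j v y $ 3)" for j
    unfolding gradient_def Q_def
    by (simp add: partial_add partial_cmult partial_mult C1s partial_nth v(1) del: times_divide_eq_left)
       (simp add: field_simps)
  have "laplacian v y = advection v v y + gradient p y"
    using ns unfolding smooth_stationary_navier_stokes_def by simp
  then have "laplacian v y $ j = v y $ 1 * partial 1 v y $ j + v y $ 2 * partial 2 v y $ j +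
      v y $ 3 * partial 3 v y $ j + partial j p y" for j
    by (simp add: advection_def sum_3 gradient_def)
  note lap = this
  have "curl (curl v) y = - laplacian v y"
    using ns unfolding smooth_stationary_navier_stokes_def by (intro curl_curl v) auto
  then show "curl (curl v) y = cross3 (v y) (curl v y) - gradient Q y"
    by (simp add: vec_eq_iff forall_3 lap gradQ cross_components curl_nth algebra_simps)
qed

text \<open>Antisymmetry of the triple product; it exchanges the roles of the vorticity at x and F
  at y in \<open>Phi\<close>.\<close>

lemma inner_cross3_swap: "a \<bullet> cross3 z b = - (b \<bullet> cross3 z a)"
  by (simp add: cross3_simps)

theorem theorem1p3:
  fixes v :: "real^3 \<Rightarrow> real^3" and p :: "real^3 \<Rightarrow> real" and q :: real
  assumes "smooth_stationary_navier_stokes v p"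
    and "(v \<longlongrightarrow> 0) at_infinity"
    and "3 / 2 \<le> q" and "q < 3"
    and "in_Lp q (curl v)"
  shows "(\<forall>x. (\<integral>\<^sup>+ y. ennreal \<bar>Phi v x y\<bar> \<partial>lebesgue) < \<infinity>) \<and>
         (\<forall>y. (\<integral>\<^sup>+ x. ennreal \<bar>Phi v x y\<bar> \<partial>lebesgue) < \<infinity>) \<and>
         (ereal_integral lebesgue (\<lambda>y. \<integral>x. Phi v x y \<partial>lebesgue) =
            ereal_integral lebesgue (\<lambda>x. \<integral>y. Phi v x y \<partial>lebesgue)
          \<longrightarrow> (\<forall>x. v x = 0))"
proof -
  let ?\<omega> = "curl v" and ?F = "\<lambda>y. cross3 (v y) (curl v y)"
  define C where "C = 15 / 2 * mollifier_mass"
  have C: "C > 0" using mollifier_mass_pos by (simp add: C_def)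
  have v: "C1 v" "\<And>i. C1 (partial i v)" and div: "\<And>y. divergence v y = 0"
    using assms(1) smooth_C1 smooth_partial unfolding smooth_stationary_navier_stokes_def by blast+
  note \<omega> = C1_curl[OF v(2)]
  have v_cont: "continuous_on UNIV v" and \<omega>_cont: "continuous_on UNIV ?\<omega>"
    by (intro C1_continuous v \<omega>)+
  have F_cont: "continuous_on UNIV ?F"
    by (intro continuous_on_cross3 v_cont \<omega>_cont)
  have [measurable]: "v \<in> borel_measurable borel" "?\<omega> \<in> borel_measurable borel"
    using v_cont \<omega>_cont by (auto intro: borel_measurable_continuous_onI)
  obtain M where M: "M \<ge> 0" "\<And>y. norm (v y) \<le> M"
    using continuous_tendsto_0_bounded[OF v_cont assms(2)] by blast
  have \<omega>_int: "integrable lborel (\<lambda>y. norm (?\<omega> y) / norm (y - x) ^ 2)" for x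
    by (rule integrable_Lp_over_dist_sq[OF \<omega>_cont _ assms(4,5)]) (use assms(3) in simp)
  \<comment> \<open>A continuous field vanishing at infinity is bounded, so F inherits the weighted
    integrability of the vorticity.\<close>
  have F_int: "integrable lborel (\<lambda>y. norm (?F y) / norm (y - x) ^ 2)" for x
  proof (rule Bochner_Integration.integrable_bound[OF integrable_mult_right[OF \<omega>_int]])
    show "AE y in lborel. norm (norm (?F y) / norm (y - x) ^ 2) \<le> norm (M * (norm (?\<omega> y) / norm (y - x) ^ 2))"
    proof (rule AE_I2)
      fix y
      have "norm (?F y) \<le> M * norm (?\<omega> y)"
        using norm_cross3_le[of "v y" "?\<omega> y"] mult_right_mono[OF M(2)[of y] norm_ge_zero[of "?\<omega> y"]] by linarith
      then have "norm (?F y) / norm (y - x) ^ 2 \<le> M * norm (?\<omega> y) / norm (y - x) ^ 2"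
        by (rule divide_right_mono) simp
      then show "norm (norm (?F y) / norm (y - x) ^ 2) \<le> norm (M * (norm (?\<omega> y) / norm (y - x) ^ 2))"
        using M(1) by simp
    qed
  qed measurable
  have r: "filterlim (\<lambda>n. real (Suc n)) at_top sequentially"
    by (rule filterlim_compose[OF filterlim_real_sequentially filterlim_Suc])
  have K\<omega>: "integrable lborel (biot_savart x ?\<omega>)" and KF: "integrable lborel (biot_savart x ?F)" for x
    by (intro integrable_biot_savart \<omega>_cont F_cont \<omega>_int F_int)+
  \<comment> \<open>Here G is the vorticity itself and Q = 0; the large averages vanish by the decay
    of v.\<close>
  have Bv: "(\<integral>y. biot_savart x ?\<omega> y \<partial>lborel) = C *\<^sub>R v x" for x
    unfolding C_def
  proof (rule integral_biot_savart[OF v(1) div _ _ \<omega>_cont \<omega>_int])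
    have "C1 (\<lambda>y::real^3. 0::real)" by (rule C1_I[OF has_derivative_const]) simp
    then show "C1 (\<lambda>y::real^3. 0::real)" .
    show "?\<omega> y = ?\<omega> y - gradient (\<lambda>y. 0) y" for y
      by (simp add: gradient_def partial_def vec_eq_iff)
    show "(\<lambda>n. mollify (real (Suc n)) x v) \<longlonglongrightarrow> 0"
      by (rule tendsto_mollify_at_top[OF v_cont assms(2) _ r]) simp
  qed
  \<comment> \<open>Now Q is the Bernoulli function, and the large averages vanish by weighted
    integrability instead of decay.\<close>
  have B\<omega>: "(\<integral>y. biot_savart x ?F y \<partial>lborel) = C *\<^sub>R ?\<omega> x" for x
    unfolding C_def
  proof (rule integral_biot_savart[OF \<omega> divergence_curl[OF v] _ _ F_cont F_int])
    show "(\<lambda>n. mollify (real (Suc n)) x ?\<omega>) \<longlonglongrightarrow> 0"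
      by (rule tendsto_mollify_at_top_integrable[OF \<omega>_cont \<omega>_int _ r]) simp
  qed (rule curl_vorticity_navier_stokes[OF assms(1)])+
  have Phi_y: "Phi v x = (\<lambda>y. - 1 / (4 * pi) * (?\<omega> x \<bullet> biot_savart x ?F y))" for x
  proof
    fix y
    have "cross3 (x - y) (?F y) = - cross3 (y - x) (?F y)"
      using cross_minus_left[of "y - x"] by simp
    then show "Phi v x y = - 1 / (4 * pi) * (?\<omega> x \<bullet> biot_savart x ?F y)"
      unfolding Phi_def biot_savart_def norm_minus_commute[of y x] by simp
  qed
  \<comment> \<open>With y fixed, the triple product is turned so that the pole is y and the
    integrand is the vorticity; integrating in x then recovers v y.\<close>
  have Phi_x: "(\<lambda>x. Phi v x y) = (\<lambda>x. - 1 / (4 * pi) * (?F y \<bullet> biot_savart y ?\<omega> x))" for y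
  proof
    fix x
    have "?\<omega> x \<bullet> cross3 (x - y) (?F y) = - (?F y \<bullet> cross3 (x - y) (?\<omega> x))"
      by (rule inner_cross3_swap)
    then show "Phi v x y = - 1 / (4 * pi) * (?F y \<bullet> biot_savart y ?\<omega> x)"
      unfolding Phi_def biot_savart_def by simp
  qed
  have int_y: "integrable lborel (Phi v x)" for x
    unfolding Phi_y by (intro integrable_mult_right integrable_inner_right KF)
  have int_x: "integrable lborel (\<lambda>x. Phi v x y)" for y
    unfolding Phi_x by (intro integrable_mult_right integrable_inner_right K\<omega>)
  have finite: "(\<integral>\<^sup>+ y. ennreal \<bar>f y\<bar> \<partial>lebesgue) < \<infinity>" if "integrable lborel f" for f :: "real^3 \<Rightarrow> real"
    using that unfolding integrable_iff_bounded nn_integral_completion by simp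
  have I_y: "(\<integral>y. Phi v x y \<partial>lebesgue) = - (C / (4 * pi) * (norm (?\<omega> x))\<^sup>2)" for x
  proof -
    have "(\<integral>y. Phi v x y \<partial>lebesgue) = (\<integral>y. Phi v x y \<partial>lborel)"
      using int_y by (intro integral_completion) auto
    also have "\<dots> = - 1 / (4 * pi) * (?\<omega> x \<bullet> (\<integral>y. biot_savart x ?F y \<partial>lborel))"
      unfolding Phi_y integral_mult_right_zero by (subst integral_inner_right) (auto intro: KF)
    finally show ?thesis by (simp add: B\<omega> power2_norm_eq_inner)
  qed
  \<comment> \<open>The integral is a multiple of F y \<bullet> v y, which is 0 because v x curl v
    is orthogonal to v.\<close>
  have I_x: "(\<integral>x. Phi v x y \<partial>lebesgue) = 0" for y
  proof -
    have "(\<integral>x. Phi v x y \<partial>lebesgue) = (\<integral>x. Phi v x y \<partial>lborel)"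
      using int_x by (intro integral_completion) auto
    also have "\<dots> = - 1 / (4 * pi) * (?F y \<bullet> (\<integral>x. biot_savart y ?\<omega> x \<partial>lborel))"
      unfolding Phi_x integral_mult_right_zero by (subst integral_inner_right) (auto intro: K\<omega>)
    finally show ?thesis by (simp add: Bv dot_cross_self)
  qed
  have "v x = 0" if eq: "ereal_integral lebesgue (\<lambda>y. \<integral>x. Phi v x y \<partial>lebesgue) =
      ereal_integral lebesgue (\<lambda>x. \<integral>y. Phi v x y \<partial>lebesgue)" for x
  proof -
    let ?g = "\<lambda>x. C / (4 * pi) * (norm (?\<omega> x))\<^sup>2"
    have g: "?g x \<ge> 0" for x using C by simp
    have "(\<integral>\<^sup>+ x. ennreal (?g x) \<partial>lebesgue) = 0"
    proof -
      let ?I = "\<integral>\<^sup>+ x. ennreal (?g x) \<partial>lebesgue"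
      \<comment> \<open>One iterated integral is 0. In the other the integrand is nonpositive, so
        the positive part contributes 0 and the value is -?I, finite or not. No indeterminate
        difference occurs, and square integrability of the vorticity is a conclusion rather than an
        assumption.\<close>
      have "0 - enn2ereal ?I = 0"
        using eq g unfolding ereal_integral_def I_x I_y by (simp add: ennreal_neg zero_ennreal.rep_eq)
      then have "enn2ereal ?I = enn2ereal 0"
        by (cases "enn2ereal ?I") (simp_all add: zero_ennreal.rep_eq zero_ereal_def)
      then show ?thesis by (simp only: enn2ereal_inject)
    qed
    then have "AE x in lborel. ennreal (?g x) = 0"
      unfolding nn_integral_completion by (subst (asm) nn_integral_0_iff_AE) auto
    then have ae: "AE x in lborel. ?\<omega> x = 0"
      using C pi_gt_zero by (auto elim!: eventually_mono simp: ennreal_eq_0_iff mult_le_0_iff zero_le_divide_iff divide_le_0_iff)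
    \<comment> \<open>Vanishing almost everywhere is enough: the integral representing v x is then 0
      at every point x.\<close>
    have "(\<integral>y. biot_savart x ?\<omega> y \<partial>lborel) = 0"
      by (rule integral_eq_zero_AE) (use ae in \<open>auto elim!: eventually_mono simp: biot_savart_def\<close>)
    then show ?thesis using Bv[of x] C by simp
  qed
  then show ?thesis using finite[OF int_y] finite[OF int_x] by blast
qed

end
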